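(* Suppose that $n\ge3$, $0<m<\frac{n-2}{n}$ and $\mu_0>0$. Let $\mu_0\le u_0\in L^p_{loc}(\overline{\Omega}\setminus\{a_1,\dots,a_{i_0}\})$ for some constant $p>\frac{n(1-m)}{2}$ satisfy $$u_0(x)\ge\frac{\lambda_i}{|x-a_i|^{\gamma_i}}\qquad\forall\,0<|x-a_i|<\delta_1,\ i=1,\dots,i_0,$$ for some constants $0<\delta_1<\delta_0$, $\lambda_1,\dots,\lambda_{i_0}>0$ and $$\gamma_1>\frac{n-2}{m},\qquad\gamma_i>\frac{2}{1-m}\quad\forall i=2,\dots,i_0,$$ and let $f\in L^\infty(\partial\Omega\times(0,\infty))$ satisfy $f\ge\mu_0$ on $\partial\Omega\times(0,\infty)$. Let $u$ be the constructed solution (defined in the context) of $$\begin{cases}u_t=\Delta u^m & \text{in }\widehat{\Omega}\times(0,\infty)\\ u=f & \text{on }\partial\Omega\times(0,\infty)\\ u(a_i,t)=\infty & \forall t>0,\ i=1,\dots,i_0\\ u(x,0)=u_0(x) & \text{in }\widehat{\Omega}.\end{cases}$$ Then $u(x,t)\to\infty$ uniformly on $K$ as $t\to\infty$ for any compact subset $K$ of $\widehat{\Omega}$.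
   Context: $\Omega\subset\mathbb{R}^n$ is a smooth bounded domain, $a_1,\dots,a_{i_0}\in\Omega$ are distinct points, $\widehat{\Omega}=\Omega\setminus\{a_1,\dots,a_{i_0}\}$, and $\delta_0=\frac13\min\left(\min_i\mathrm{dist}(a_i,\partial\Omega),\min_{i\ne j}|a_i-a_j|\right)$. A solution $u$ of the problem in the claim is a function $u$, positive in $\widehat{\Omega}\times(0,\infty)$, satisfying $u_t=\Delta u^m$ there in the classical sense, such that: (i) $\|u(\cdot,t)-u_0\|_{L^1(K)}\to0$ as $t\to0$ for any compact $K\subset\widehat{\Omega}$; (ii) for any $0<t_1<t_2<\infty$ and any $\eta\in C_c^2((\overline{\Omega}\setminus\{a_1,\dots,a_{i_0}\})\times(0,\infty))$ with $\eta\equiv0$ on $\partial\Omega\times(0,\infty)$, $$\int_{t_1}^{t_2}\!\int_{\widehat{\Omega}}(u\eta_t+u^m\Delta\eta)\,dx\,dt=\int_{t_1}^{t_2}\!\int_{\partial\Omega}f^m\frac{\partial\eta}{\partial\nu}\,d\sigma\,dt+\int_{\widehat{\Omega}}u\eta\,dx\Big|_{t=t_1}^{t=t_2},$$ where $\nu$ is the unit outward normal; (iii) $u(x,t)\to\infty$ as $x\to a_i$ for every $t>0$ and $i=1,\dots,i_0$. The constructed solution (the one given by the paper's existence theorem). For $0<\varepsilon<1$, $M>0$ let $u_{\varepsilon,M}$ be the unique solution of $u_t=\Delta u^m$ in $\Omega\times(0,\infty)$, $u=f+\varepsilon$ on $\partial\Omega\times(0,\infty)$, $u(x,0)=\min(u_0(x),M)+\varepsilon$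 in $\Omega$, satisfying $\varepsilon\le u_{\varepsilon,M}\le\max(M,\|f\|_{L^\infty})+\varepsilon$. (Here a solution is positive and classical in $\Omega\times(0,\infty)$, converges to its initial value in $L^1(K)$ as $t\to0$ for each compact $K\subset\Omega$, and satisfies the integral identity in (ii) with $\widehat{\Omega}$ replaced by $\Omega$, $f$ by $f+\varepsilon$, and test functions $\eta\in C^2_c(\overline{\Omega}\times(0,\infty))$ vanishing on $\partial\Omega\times(0,\infty)$.) The functions $u_{\varepsilon,M}$ are monotone in $\varepsilon$ and $M$, and the constructed solution is $u(x,t)=\lim_{M\to\infty}\lim_{\varepsilon\to0}u_{\varepsilon,M}(x,t)$, $x\in\widehat{\Omega}$, $t>0$. *)

theory Defs
  imports "HOL-Probability.Essential_Supremum"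
begin

section \<open>Differentiation in Euclidean space\<close>

definition dir_deriv :: "'a::euclidean_space \<Rightarrow> ('a \<Rightarrow> real) \<Rightarrow> 'a \<Rightarrow> real" where
  "dir_deriv v f x = frechet_derivative f (at x) v"

definition grad :: "('a::euclidean_space \<Rightarrow> real) \<Rightarrow> 'a \<Rightarrow> 'a" where
  "grad f x = (\<Sum>i\<in>Basis. dir_deriv i f x *\<^sub>R i)"

definition laplacian :: "('a::euclidean_space \<Rightarrow> real) \<Rightarrow> 'a \<Rightarrow> real" where
  "laplacian f x = (\<Sum>i\<in>Basis. dir_deriv i (dir_deriv i f) x)"

text \<open>\<open>Ck_on k S f\<close> is meant for open \<open>S\<close>, where it is the usual class \<open>C^k(S)\<close>.\<close>

primrec Ck_on :: "nat \<Rightarrow> 'a::euclidean_space set \<Rightarrow> ('a \<Rightarrow> real) \<Rightarrow> bool" where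
  "Ck_on 0 S f \<longleftrightarrow> continuous_on S f"
| "Ck_on (Suc k) S f \<longleftrightarrow> f differentiable_on S \<and> (\<forall>i\<in>Basis. Ck_on k S (dir_deriv i f))"

text \<open>Functions of \<open>(x, t)\<close>: spatial operators act on the slice at time \<open>t\<close>.\<close>

definition time_deriv :: "('a \<times> real \<Rightarrow> real) \<Rightarrow> 'a \<times> real \<Rightarrow> real" where
  "time_deriv u z = deriv (\<lambda>s. u (fst z, s)) (snd z)"

definition space_deriv ::
  "'a::euclidean_space \<Rightarrow> ('a \<times> real \<Rightarrow> real) \<Rightarrow> 'a \<times> real \<Rightarrow> real" where
  "space_deriv v u z = dir_deriv v (\<lambda>x. u (x, snd z)) (fst z)"

definition space_laplacian :: "('a::euclidean_space \<times> real \<Rightarrow> real) \<Rightarrow> 'a \<times> real \<Rightarrow> real" where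
  "space_laplacian u z = laplacian (\<lambda>x. u (x, snd z)) (fst z)"

text \<open>The parabolic class \<open>C^{2,1}\<close> of classical solutions, for open \<open>D\<close>.\<close>

definition C21_on :: "('a::euclidean_space \<times> real) set \<Rightarrow> ('a \<times> real \<Rightarrow> real) \<Rightarrow> bool" where
  "C21_on D u \<longleftrightarrow>
     continuous_on D u \<and>
     (\<forall>(x, t)\<in>D. (\<lambda>s. u (x, s)) differentiable (at t)) \<and>
     continuous_on D (time_deriv u) \<and>
     (\<forall>(x, t)\<in>D. (\<lambda>y. u (y, t)) differentiable (at x)) \<and>
     (\<forall>i\<in>Basis.
        continuous_on D (space_deriv i u) \<and>
        (\<forall>(x, t)\<in>D. (\<lambda>y. space_deriv i u (y, t)) differentiable (at x)) \<and>
        (\<forall>j\<in>Basis. continuous_on D (space_deriv j (space_deriv i u))))"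

text \<open>
  The class \<open>C_c^2(S)\<close> for \<open>S = (closure \<Omega> - A) \<times> (0, \<infinity>)\<close>, which contains boundary points of \<open>\<Omega>\<close>:
  \<open>C^2\<close> up to the boundary means being the restriction of a \<open>C^2\<close> function on an open
  neighbourhood of \<open>S\<close>, and the support is compact relative to \<open>S\<close>.
\<close>

definition C2c_on :: "('a::euclidean_space) set \<Rightarrow> ('a \<Rightarrow> real) \<Rightarrow> bool" where
  "C2c_on S \<eta> \<longleftrightarrow>
     (\<exists>W. open W \<and> S \<subseteq> W \<and> Ck_on 2 W \<eta>) \<and>
     (\<exists>K. compact K \<and> K \<subseteq> S \<and> (\<forall>z\<in>S - K. \<eta> z = 0))"


section \<open>Smooth bounded domains, outward normal, surface measure\<close>

definition local_defining_function ::
  "'a::euclidean_space set \<Rightarrow> 'a \<Rightarrow> 'a set \<Rightarrow> ('a \<Rightarrow> real) \<Rightarrow> bool" where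
  "local_defining_function \<Omega> p U \<phi> \<longleftrightarrow>
     open U \<and> p \<in> U \<and> (\<forall>k. Ck_on k U \<phi>) \<and> (\<forall>x\<in>U. grad \<phi> x \<noteq> 0) \<and>
     \<Omega> \<inter> U = {x\<in>U. \<phi> x < 0}"

definition smooth_bounded_domain :: "'a::euclidean_space set \<Rightarrow> bool" where
  "smooth_bounded_domain \<Omega> \<longleftrightarrow>
     open \<Omega> \<and> connected \<Omega> \<and> bounded \<Omega> \<and> \<Omega> \<noteq> {} \<and>
     (\<forall>p\<in>frontier \<Omega>. \<exists>U \<phi>. local_defining_function \<Omega> p U \<phi>)"

definition outward_normal :: "'a::euclidean_space set \<Rightarrow> 'a \<Rightarrow> 'a" where
  "outward_normal \<Omega> p =
     (THE v. \<exists>U \<phi>. local_defining_function \<Omega> p U \<phi> \<and> v = grad \<phi> p /\<^sub>R norm (grad \<phi> p))"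

text \<open>
  Surface measure is the \<open>(n - 1)\<close>-dimensional Hausdorff measure, normalised by the volume of
  the unit ball so that it agrees with Lebesgue measure on flat pieces.
\<close>

definition hausdorff_weight :: "nat \<Rightarrow> 'a::metric_space set \<Rightarrow> ennreal" where
  "hausdorff_weight k C =
     (if C = {} then 0 else ennreal (unit_ball_vol (real k) * (diameter C / 2) ^ k))"

definition hausdorff_pre :: "nat \<Rightarrow> real \<Rightarrow> 'a::metric_space set \<Rightarrow> ennreal" where
  "hausdorff_pre k \<delta> X =
     (INF C\<in>{C::nat \<Rightarrow> 'a set. X \<subseteq> (\<Union>i. C i) \<and> (\<forall>i. bounded (C i) \<and> diameter (C i) \<le> \<delta>)}.
        \<Sum>i. hausdorff_weight k (C i))"

definition hausdorff_outer :: "nat \<Rightarrow> 'a::metric_space set \<Rightarrow> ennreal" where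
  "hausdorff_outer k X = (SUP \<delta>\<in>{0<..}. hausdorff_pre k \<delta> X)"

definition hausdorff_measure :: "nat \<Rightarrow> 'a::metric_space measure" where
  "hausdorff_measure k = measure_of UNIV (sets borel) (hausdorff_outer k)"

text \<open>\<open>hausdorff_outer\<close> is a metric outer measure, so it is countably additive on Borel sets.\<close>

lemma hausdorff_weight_empty [simp]: "hausdorff_weight k {} = 0"
  by (simp add: hausdorff_weight_def)

lemma hausdorff_pre_le:
  assumes "X \<subseteq> (\<Union>i. C i)" "\<And>i::nat. bounded (C i)" "\<And>i. diameter (C i) \<le> \<delta>"
  shows "hausdorff_pre k \<delta> X \<le> (\<Sum>i. hausdorff_weight k (C i))"
  unfolding hausdorff_pre_def by (rule INF_lower) (use assms in auto)

lemma hausdorff_pre_mono: "X \<subseteq> Y \<Longrightarrow> hausdorff_pre k \<delta> X \<le> hausdorff_pre k \<delta> Y"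
  unfolding hausdorff_pre_def by (rule INF_superset_mono) auto

lemma hausdorff_pre_antimono: "\<delta> \<le> \<delta>' \<Longrightarrow> hausdorff_pre k \<delta>' X \<le> hausdorff_pre k \<delta> X"
  unfolding hausdorff_pre_def by (rule INF_superset_mono) (auto intro: order_trans)

lemma hausdorff_pre_empty: "0 < \<delta> \<Longrightarrow> hausdorff_pre k \<delta> ({} :: 'a::metric_space set) = 0"
  using hausdorff_pre_le[of "{}" "\<lambda>_. {} :: 'a set" \<delta> k] by simp

lemma hausdorff_pre_UN:
  fixes X :: "nat \<Rightarrow> 'a::metric_space set"
  shows "hausdorff_pre k \<delta> (\<Union>n. X n) \<le> (\<Sum>n. hausdorff_pre k \<delta> (X n))"
proof (rule ennreal_le_epsilon)
  fix e :: real
  assume fin: "(\<Sum>n. hausdorff_pre k \<delta> (X n)) < top" and e: "0 < e"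
  have "\<exists>C. X n \<subseteq> (\<Union>i. C i) \<and> (\<forall>i. bounded (C i) \<and> diameter (C i) \<le> \<delta>) \<and>
      (\<Sum>i. hausdorff_weight k (C i)) \<le> hausdorff_pre k \<delta> (X n) + ennreal (e * (1/2) ^ Suc n)" for n
  proof -
    have lt: "hausdorff_pre k \<delta> (X n) < hausdorff_pre k \<delta> (X n) + ennreal (e * (1/2) ^ Suc n)"
    proof -
      have "hausdorff_pre k \<delta> (X n) \<le> (\<Sum>n. hausdorff_pre k \<delta> (X n))"
        using sum_le_suminf[of "\<lambda>n. hausdorff_pre k \<delta> (X n)" "{n}"] by simp
      then have "hausdorff_pre k \<delta> (X n) \<noteq> top" using fin by (auto simp: top_unique)
      moreover have "0 < ennreal (e * (1/2) ^ Suc n)" using e by simp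
      ultimately show ?thesis by (metis ennreal_add_left_cancel_less add.right_neutral infinity_ennreal_def)
    qed
    then obtain C where "C \<in> {C::nat \<Rightarrow> 'a set. X n \<subseteq> (\<Union>i. C i) \<and> (\<forall>i. bounded (C i) \<and> diameter (C i) \<le> \<delta>)}"
      "(\<Sum>i. hausdorff_weight k (C i)) < hausdorff_pre k \<delta> (X n) + ennreal (e * (1/2) ^ Suc n)"
      unfolding hausdorff_pre_def INF_less_iff by auto
    then show ?thesis by (auto intro: less_imp_le)
  qed
  then obtain C where C: "\<And>n. X n \<subseteq> (\<Union>i. C n i)" "\<And>n i. bounded (C n i)"
      "\<And>n i. diameter (C n i) \<le> \<delta>"
      "\<And>n. (\<Sum>i. hausdorff_weight k (C n i)) \<le> hausdorff_pre k \<delta> (X n) + ennreal (e * (1/2) ^ Suc n)"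
    by metis
  define D where "D = (\<lambda>i. case prod_decode i of (n, j) \<Rightarrow> C n j)"
  have "(\<Union>n. X n) \<subseteq> (\<Union>i. D i)"
  proof
    fix x assume "x \<in> (\<Union>n. X n)"
    then obtain n j where "x \<in> C n j" using C(1) by blast
    then have "x \<in> D (prod_encode (n, j))" by (simp add: D_def)
    then show "x \<in> (\<Union>i. D i)" by blast
  qed
  then have "hausdorff_pre k \<delta> (\<Union>n. X n) \<le> (\<Sum>i. hausdorff_weight k (D i))"
    by (rule hausdorff_pre_le) (use C in \<open>auto simp: D_def split: prod.splits\<close>)
  also have "\<dots> = (\<Sum>i. (\<lambda>(n, j). hausdorff_weight k (C n j)) (prod_decode i))"
    by (simp add: D_def split_def)
  also have "\<dots> = (\<Sum>n. \<Sum>i. hausdorff_weight k (C n i))"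
    by (rule suminf_ennreal_2dimen) simp
  also have "\<dots> \<le> (\<Sum>n. hausdorff_pre k \<delta> (X n) + ennreal (e * (1/2) ^ Suc n))"
    by (intro suminf_le C summableI)
  also have "\<dots> = (\<Sum>n. hausdorff_pre k \<delta> (X n)) + (\<Sum>n. ennreal (e * (1/2) ^ Suc n))"
    by (rule suminf_add[symmetric]) auto
  also have "(\<Sum>n. ennreal (e * (1/2) ^ Suc n)) = ennreal e"
    using sums_mult[OF power_half_series, of e] e by (subst suminf_ennreal_eq) auto
  finally show "hausdorff_pre k \<delta> (\<Union>n. X n) \<le> (\<Sum>n. hausdorff_pre k \<delta> (X n)) + ennreal e" .
qed

lemma hausdorff_outer_mono: "X \<subseteq> Y \<Longrightarrow> hausdorff_outer k X \<le> hausdorff_outer k Y"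
  unfolding hausdorff_outer_def by (intro SUP_mono') (rule hausdorff_pre_mono)

lemma hausdorff_outer_empty [simp]: "hausdorff_outer k ({} :: 'a::metric_space set) = 0"
  unfolding hausdorff_outer_def
  by (rule antisym) (auto intro!: SUP_least simp: hausdorff_pre_empty)

lemma hausdorff_outer_UN:
  fixes X :: "nat \<Rightarrow> 'a::metric_space set"
  shows "hausdorff_outer k (\<Union>n. X n) \<le> (\<Sum>n. hausdorff_outer k (X n))"
  unfolding hausdorff_outer_def[of k "\<Union>n. X n"]
proof (rule SUP_least)
  fix \<delta> :: real assume "\<delta> \<in> {0<..}"
  then have "(\<Sum>n. hausdorff_pre k \<delta> (X n)) \<le> (\<Sum>n. hausdorff_outer k (X n))"
    by (intro suminf_le summableI) (auto simp: hausdorff_outer_def intro: SUP_upper)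
  then show "hausdorff_pre k \<delta> (\<Union>n. X n) \<le> (\<Sum>n. hausdorff_outer k (X n))"
    using hausdorff_pre_UN order_trans by blast
qed

lemma hausdorff_outer_measure_space:
  "outer_measure_space UNIV (hausdorff_outer k :: 'a::metric_space set \<Rightarrow> ennreal)"
  unfolding outer_measure_space_def positive_def increasing_def countably_subadditive_def
  by (auto intro: hausdorff_outer_mono hausdorff_outer_UN)

lemma hausdorff_outer_Un_le:
  "hausdorff_outer k (A \<union> B) \<le> hausdorff_outer k A + hausdorff_outer k (B :: 'a::metric_space set)"
  using hausdorff_outer_UN[of k "binaryset A B"]
    suminf_binaryset_eq[of "hausdorff_outer k" A B]
  by (simp add: UN_binaryset_eq)

lemma hausdorff_outer_separated:
  fixes A B :: "'a::metric_space set"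
  assumes d: "0 < d" "\<And>x y. x \<in> A \<Longrightarrow> y \<in> B \<Longrightarrow> d \<le> dist x y"
  shows "hausdorff_outer k (A \<union> B) = hausdorff_outer k A + hausdorff_outer k B"
proof (rule antisym[OF hausdorff_outer_Un_le])
  have *: "hausdorff_pre k \<delta> A + hausdorff_pre k \<delta> B \<le> hausdorff_pre k \<delta> (A \<union> B)" if "\<delta> < d" for \<delta>
    unfolding hausdorff_pre_def[of k \<delta> "A \<union> B"]
  proof (rule INF_greatest, clarify)
    fix C :: "nat \<Rightarrow> 'a set"
    assume cov: "A \<union> B \<subseteq> (\<Union>i. C i)" and C: "\<forall>i. bounded (C i) \<and> diameter (C i) \<le> \<delta>"
    define CA where "CA i = (if C i \<inter> A = {} then {} else C i)" for i
    define CB where "CB i = (if C i \<inter> B = {} then {} else C i)" for i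
    have diam: "diameter (C i) \<le> \<delta>" "bounded (C i)" for i using C by auto
    then have \<delta>0: "0 \<le> \<delta>" using diameter_ge_0 order_trans by blast
    have "C i \<inter> A = {} \<or> C i \<inter> B = {}" for i
    proof (rule ccontr)
      assume "\<not> ?thesis"
      then obtain x y where xy: "x \<in> C i" "x \<in> A" "y \<in> C i" "y \<in> B" by blast
      then have "d \<le> dist x y" "dist x y \<le> diameter (C i)"
        using d(2) diameter_bounded_bound[OF diam(2)] by auto
      then show False using diam(1)[of i] \<open>\<delta> < d\<close> by linarith
    qed
    then have w: "hausdorff_weight k (CA i) + hausdorff_weight k (CB i) \<le> hausdorff_weight k (C i)" for i
      by (auto simp: CA_def CB_def) 
    have "hausdorff_pre k \<delta> A \<le> (\<Sum>i. hausdorff_weight k (CA i))"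
    proof (rule hausdorff_pre_le)
      show "A \<subseteq> (\<Union>i. CA i)"
      proof
        fix x assume x: "x \<in> A"
        then obtain i where "x \<in> C i" using cov by blast
        then have "x \<in> CA i" using x by (auto simp: CA_def)
        then show "x \<in> (\<Union>i. CA i)" by blast
      qed
    qed (use diam \<delta>0 in \<open>auto simp: CA_def\<close>)
    moreover have "hausdorff_pre k \<delta> B \<le> (\<Sum>i. hausdorff_weight k (CB i))"
    proof (rule hausdorff_pre_le)
      show "B \<subseteq> (\<Union>i. CB i)"
      proof
        fix x assume x: "x \<in> B"
        then obtain i where "x \<in> C i" using cov by blast
        then have "x \<in> CB i" using x by (auto simp: CB_def)
        then show "x \<in> (\<Union>i. CB i)" by blast
      qed
    qed (use diam \<delta>0 in \<open>auto simp: CB_def\<close>)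
    ultimately have "hausdorff_pre k \<delta> A + hausdorff_pre k \<delta> B
        \<le> (\<Sum>i. hausdorff_weight k (CA i)) + (\<Sum>i. hausdorff_weight k (CB i))"
      by (rule add_mono)
    also have "\<dots> = (\<Sum>i. hausdorff_weight k (CA i) + hausdorff_weight k (CB i))"
      by (rule suminf_add) auto
    also have "\<dots> \<le> (\<Sum>i. hausdorff_weight k (C i))"
      by (intro suminf_le w summableI)
    finally show "hausdorff_pre k \<delta> A + hausdorff_pre k \<delta> B \<le> (\<Sum>i. hausdorff_weight k (C i))" .
  qed
  have "(SUP \<delta>\<in>{0<..}. hausdorff_pre k \<delta> A) + (SUP \<delta>\<in>{0<..}. hausdorff_pre k \<delta> B)
      = (SUP \<delta>\<in>{0<..}. hausdorff_pre k \<delta> A + hausdorff_pre k \<delta> B)"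
  proof (rule SUP_add_directed_ennreal[symmetric])
    fix i j :: real assume "i \<in> {0<..}" "j \<in> {0<..}"
    then show "\<exists>l\<in>{0<..}. hausdorff_pre k i A + hausdorff_pre k j B
        \<le> hausdorff_pre k l A + hausdorff_pre k l B"
      by (intro bexI[of _ "min i j"] add_mono hausdorff_pre_antimono) auto
  qed
  also have "\<dots> \<le> hausdorff_outer k (A \<union> B)"
  proof (rule SUP_least)
    fix \<delta> :: real assume \<delta>: "\<delta> \<in> {0<..}"
    let ?e = "min \<delta> (d / 2)"
    have "hausdorff_pre k \<delta> A + hausdorff_pre k \<delta> B \<le> hausdorff_pre k ?e A + hausdorff_pre k ?e B"
      by (intro add_mono hausdorff_pre_antimono) auto
    also have "\<dots> \<le> hausdorff_pre k ?e (A \<union> B)" using d by (intro *) auto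
    also have "\<dots> \<le> hausdorff_outer k (A \<union> B)"
      unfolding hausdorff_outer_def using \<delta> d by (intro SUP_upper) auto
    finally show "hausdorff_pre k \<delta> A + hausdorff_pre k \<delta> B \<le> hausdorff_outer k (A \<union> B)" .
  qed
  finally show "hausdorff_outer k A + hausdorff_outer k B \<le> hausdorff_outer k (A \<union> B)"
    unfolding hausdorff_outer_def[of k A] hausdorff_outer_def[of k B] .
qed

lemma hausdorff_outer_closed_caratheodory:
  fixes F X :: "'a::metric_space set"
  assumes F: "closed F"
  shows "hausdorff_outer k (F \<inter> X) + hausdorff_outer k (X - F) \<le> hausdorff_outer k X"
proof (cases "F = {} \<or> hausdorff_outer k X = top")
  case True
  then show ?thesis by auto
next
  case False
  then have ne: "F \<noteq> {}" and fin: "hausdorff_outer k X < top" by (auto simp: less_top)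
  let ?H = "hausdorff_outer k"
  define D where "D x = infdist x F" for x
  define Y where "Y n = {x\<in>X. 1 / Suc n \<le> D x}" for n :: nat
  define R where "R n = {x\<in>X. 1 / Suc (Suc n) \<le> D x \<and> D x < 1 / Suc n}" for n :: nat
  have D_le: "D x \<le> D y + dist x y" for x y
    unfolding D_def by (rule infdist_triangle)
  have pos: "0 < D x" if "x \<in> X - F" for x
    using that F ne by (simp add: D_def infdist_pos_not_in_closed)
  have sepR: "?H (\<Union>i<N. R (2 * i + c)) = (\<Sum>i<N. ?H (R (2 * i + c)))" for N c
  proof (induction N)
    case (Suc N)
    let ?p = "2 * N + c"
    have "?H ((\<Union>i<N. R (2 * i + c)) \<union> R ?p) = ?H (\<Union>i<N. R (2 * i + c)) + ?H (R ?p)"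
    proof (cases N)
      case (Suc N')
      show ?thesis
      proof (rule hausdorff_outer_separated)
        show "0 < 1 / real ?p - 1 / real (Suc ?p)"
        proof -
          have "0 < real ?p" using Suc by simp
          then have "1 / real (Suc ?p) < 1 / real ?p"
            by (intro divide_strict_left_mono) auto
          then show ?thesis by linarith
        qed
        fix x y assume "x \<in> (\<Union>i<N. R (2 * i + c))" "y \<in> R ?p"
        then obtain i where i: "i < N" "1 / real (Suc (Suc (2 * i + c))) \<le> D x"
            and y: "D y < 1 / real (Suc ?p)"
          by (auto simp: R_def)
        have "1 / real ?p \<le> 1 / real (Suc (Suc (2 * i + c)))"
          using i by (intro divide_left_mono) auto
        then have "1 / real ?p \<le> D x" using i by linarith
        then show "1 / real ?p - 1 / real (Suc ?p) \<le> dist x y"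
          using D_le[of x y] y by linarith
      qed
    qed auto
    moreover have "(\<Union>i<Suc N. R (2 * i + c)) = (\<Union>i<N. R (2 * i + c)) \<union> R ?p"
      by (auto simp: less_Suc_eq)
    ultimately show ?case using Suc by simp
  qed auto
  have fin_c: "(\<Sum>i. ?H (R (2 * i + c))) < top" for c
  proof -
    have "(\<Sum>i. ?H (R (2 * i + c))) \<le> ?H X"
    proof (rule suminf_le_const[OF summableI])
      fix N
      have "(\<Union>i<N. R (2 * i + c)) \<subseteq> X" by (auto simp: R_def)
      then show "(\<Sum>i<N. ?H (R (2 * i + c))) \<le> ?H X"
        using hausdorff_outer_mono sepR by metis
    qed
    then show ?thesis using fin by simp
  qed
  have finR: "(\<Sum>i. ?H (R i)) < top"
  proof -
    have "(\<Sum>i. ?H (R i)) \<le> (\<Sum>i. ?H (R (2 * i + 0))) + (\<Sum>i. ?H (R (2 * i + 1)))"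
    proof (rule suminf_le_const[OF summableI])
      fix N
      have split: "(\<Sum>i<2 * n. ?H (R i)) = (\<Sum>i<n. ?H (R (2 * i + 0))) + (\<Sum>i<n. ?H (R (2 * i + 1)))" for n
        by (induction n) (auto simp: add_ac)
      have "(\<Sum>i<N. ?H (R i)) \<le> (\<Sum>i<2 * N. ?H (R i))"
        by (rule sum_mono2) auto
      also have "\<dots> \<le> (\<Sum>i. ?H (R (2 * i + 0))) + (\<Sum>i. ?H (R (2 * i + 1)))"
        unfolding split by (intro add_mono sum_le_suminf summableI) auto
      finally show "(\<Sum>i<N. ?H (R i)) \<le> \<dots>" .
    qed
    then show ?thesis using fin_c[of 0] fin_c[of 1] by (simp add: less_top order_le_less_trans)
  qed
  have tail: "(\<lambda>n. \<Sum>i. ?H (R (i + n))) \<longlonglongrightarrow> 0"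
  proof -
    define r where "r i = enn2real (?H (R i))" for i
    have "?H (R i) \<noteq> top" for i
      using finR sum_le_suminf[OF summableI, of "{i}" "\<lambda>i. ?H (R i)"] by (auto simp: top_unique)
    then have r: "?H (R i) = ennreal (r i)" for i by (simp add: r_def less_top)
    have r0: "0 \<le> r i" for i by (simp add: r_def)
    have sr: "summable r"
      using finR r0 unfolding r by (intro summable_suminf_not_top) auto
    have "(\<Sum>i. ?H (R (i + n))) = ennreal (\<Sum>i. r (i + n))" for n
      unfolding r using sr r0 by (intro suminf_ennreal2) (auto simp: summable_iff_shift)
    moreover have "(\<lambda>n. \<Sum>i. r (i + n)) \<longlonglongrightarrow> 0"
      by (rule suminf_exist_split2[OF sr])
    ultimately show ?thesis
      using tendsto_ennrealI[of "\<lambda>n. \<Sum>i. r (i + n)" 0 sequentially] by simp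
  qed
  have step: "?H (F \<inter> X) + ?H (X - F) \<le> ?H X + (\<Sum>i. ?H (R (i + n)))" for n
  proof -
    have "X - F \<subseteq> Y n \<union> (\<Union>i. R (i + n))"
    proof
      fix x assume x: "x \<in> X - F"
      show "x \<in> Y n \<union> (\<Union>i. R (i + n))"
      proof (cases "x \<in> Y n")
        case False
        define q where "q = (LEAST q. 1 / real (Suc q) \<le> D x)"
        have "\<exists>q. 1 / real (Suc q) \<le> D x"
          using nat_approx_posE[OF pos[OF x]] by (meson less_imp_le)
        then have q: "1 / real (Suc q) \<le> D x" unfolding q_def by (rule LeastI_ex)
        have small: "D x < 1 / real (Suc j)" if "j < q" for j
          using not_less_Least[of j "\<lambda>q. 1 / real (Suc q) \<le> D x"] that by (auto simp: q_def)
        have "n < q"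
        proof (rule ccontr)
          assume "\<not> n < q"
          then have "1 / real (Suc n) \<le> 1 / real (Suc q)" by (intro divide_left_mono) auto
          then show False using q False x by (auto simp: Y_def)
        qed
        then obtain j where j: "q = Suc (j + n)"
          by (metis add.commute less_imp_Suc_add)
        then have "x \<in> R (j + n)" using q small[of "j + n"] x by (auto simp: R_def)
        then show ?thesis by blast
      qed auto
    qed
    then have "?H (X - F) \<le> ?H (Y n \<union> (\<Union>i. R (i + n)))" by (rule hausdorff_outer_mono)
    also have "\<dots> \<le> ?H (Y n) + (\<Sum>i. ?H (R (i + n)))"
      by (intro order_trans[OF hausdorff_outer_Un_le] add_left_mono hausdorff_outer_UN)
    finally have "?H (F \<inter> X) + ?H (X - F) \<le> (?H (F \<inter> X) + ?H (Y n)) + (\<Sum>i. ?H (R (i + n)))"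
      by (simp add: add_left_mono add.assoc)
    also have "?H (F \<inter> X) + ?H (Y n) = ?H (F \<inter> X \<union> Y n)"
    proof (rule hausdorff_outer_separated[symmetric])
      show "0 < 1 / real (Suc n)" by simp
      fix x y assume xy: "x \<in> F \<inter> X" "y \<in> Y n"
      then have "1 / real (Suc n) \<le> infdist y F" by (simp add: Y_def D_def)
      also have "\<dots> \<le> dist y x" using xy by (intro infdist_le) auto
      finally show "1 / real (Suc n) \<le> dist x y" by (simp add: dist_commute)
    qed
    also have "\<dots> \<le> ?H X" by (rule hausdorff_outer_mono) (auto simp: Y_def)
    finally show ?thesis by (simp add: add_right_mono)
  qed
  have "(\<lambda>n. ?H X + (\<Sum>i. ?H (R (i + n)))) \<longlonglongrightarrow> ?H X + 0"
    by (intro tendsto_add tendsto_const tail)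
  then show ?thesis
    using step by (intro LIMSEQ_le_const[where X = "\<lambda>n. ?H X + (\<Sum>i. ?H (R (i + n)))"]) auto
qed

lemma sets_hausdorff_measure [simp, measurable_cong]: "sets (hausdorff_measure k) = sets borel"
  unfolding hausdorff_measure_def
  by (metis sets.sigma_sets_eq sets_measure_of sets.space_closed space_borel)

lemma space_hausdorff_measure [simp]: "space (hausdorff_measure k) = UNIV"
  by (simp add: hausdorff_measure_def space_measure_of_conv)

theorem emeasure_hausdorff_measure:
  fixes B :: "'a::metric_space set"
  assumes B: "B \<in> sets borel"
  shows "emeasure (hausdorff_measure k) B = hausdorff_outer k B"
proof -
  interpret sigma_algebra UNIV "UNIV :: 'a set set"
    using sigma_algebra_Pow[of "UNIV :: 'a set"] by simp
  let ?L = "lambda_system UNIV UNIV (hausdorff_outer k :: 'a set \<Rightarrow> ennreal)"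
  have ms: "measure_space UNIV ?L (hausdorff_outer k)"
    by (rule caratheodory_lemma[OF hausdorff_outer_measure_space])
  then interpret L: sigma_algebra UNIV ?L
    by (simp add: measure_space_def)
  have "F \<in> ?L" if "closed F" for F
  proof -
    have "hausdorff_outer k X \<le> hausdorff_outer k (F \<inter> X) + hausdorff_outer k (X - F)" for X
      by (rule order_trans[OF hausdorff_outer_mono hausdorff_outer_Un_le]) blast
    then have "hausdorff_outer k (F \<inter> X) + hausdorff_outer k (X - F) = hausdorff_outer k X" for X
      by (rule antisym[OF hausdorff_outer_closed_caratheodory[OF that]])
    then have "hausdorff_outer k (X \<inter> F) + hausdorff_outer k (X - F) = hausdorff_outer k X" for X
      by (subst Int_commute)
    then show ?thesis
      unfolding lambda_system_eq by (intro CollectI conjI UNIV_I ballI)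
  qed
  then have "Collect closed \<subseteq> ?L" by blast
  then have "sigma_sets UNIV (Collect closed) \<subseteq> ?L" by (rule L.sigma_sets_subset)
  then have sub: "sets borel \<subseteq> ?L"
    unfolding borel_eq_closed by (subst sets_measure_of) simp_all
  have "countably_additive (sets borel) (hausdorff_outer k :: 'a set \<Rightarrow> ennreal)"
    using ms sub unfolding measure_space_def countably_additive_def by blast
  then show ?thesis
    using B hausdorff_outer_empty
    by (intro emeasure_measure_of[OF hausdorff_measure_def]) (auto simp: positive_def)
qed

definition surface_measure :: "'a::euclidean_space set \<Rightarrow> 'a measure" where
  "surface_measure \<Omega> = restrict_space (hausdorff_measure (DIM('a) - 1)) (frontier \<Omega>)"

definition lateral_measure :: "'a::euclidean_space set \<Rightarrow> ('a \<times> real) measure" where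
  "lateral_measure \<Omega> = surface_measure \<Omega> \<Otimes>\<^sub>M restrict_space lborel {0<..}"


section \<open>Lebesgue spaces\<close>

definition Lp_loc :: "real \<Rightarrow> 'a::euclidean_space set \<Rightarrow> ('a \<Rightarrow> real) \<Rightarrow> bool" where
  "Lp_loc p S g \<longleftrightarrow>
     (\<forall>K. compact K \<longrightarrow> K \<subseteq> S \<longrightarrow>
        set_borel_measurable lebesgue K g \<and> set_integrable lebesgue K (\<lambda>x. \<bar>g x\<bar> powr p))"

definition Linf_norm :: "'a measure \<Rightarrow> ('a \<Rightarrow> real) \<Rightarrow> ereal" where
  "Linf_norm M g = esssup M (\<lambda>z. ereal \<bar>g z\<bar>)"

text \<open>Elements of \<open>L^\<infinity>(M)\<close> are represented by \<open>M\<close>-measurable functions.\<close>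

definition Linf :: "'a measure \<Rightarrow> ('a \<Rightarrow> real) \<Rightarrow> bool" where
  "Linf M g \<longleftrightarrow> g \<in> borel_measurable M \<and> Linf_norm M g < \<infinity>"


section \<open>The equation \<open>u\<^sub>t = \<Delta> u\<^sup>m\<close>\<close>

text \<open>
  The identity required of a solution, with lateral boundary values \<open>f\<close>, for test functions on
  \<open>(closure \<Omega> - A) \<times> (0, \<infinity>)\<close>. As the Bochner integral of a non-integrable function is \<open>0\<close>,
  existence of the volume integrals is stated separately; the boundary integrand is bounded.
\<close>

definition weak_identity ::
  "real \<Rightarrow> 'a::euclidean_space set \<Rightarrow> 'a set \<Rightarrow> ('a \<times> real \<Rightarrow> real) \<Rightarrow> ('a \<times> real \<Rightarrow> real) \<Rightarrow> bool" where
  "weak_identity m \<Omega> A f u \<longleftrightarrow>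
     (\<forall>t1 t2 \<eta>. 0 < t1 \<longrightarrow> t1 < t2 \<longrightarrow>
        C2c_on ((closure \<Omega> - A) \<times> {0<..}) \<eta> \<longrightarrow>
        (\<forall>x\<in>frontier \<Omega>. \<forall>t>0. \<eta> (x, t) = 0) \<longrightarrow>
        set_integrable lebesgue ((\<Omega> - A) \<times> {t1..t2})
          (\<lambda>z. u z * time_deriv \<eta> z + u z powr m * space_laplacian \<eta> z) \<and>
        (\<forall>t\<in>{t1, t2}. set_integrable lebesgue (\<Omega> - A) (\<lambda>x. u (x, t) * \<eta> (x, t))) \<and>
        (LINT t:{t1..t2}|lebesgue. LINT x:\<Omega> - A|lebesgue.
           u (x, t) * time_deriv \<eta> (x, t) + u (x, t) powr m * space_laplacian \<eta> (x, t))
        = (LINT t:{t1..t2}|lebesgue. LINT x|surface_measure \<Omega>.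
             f (x, t) powr m * space_deriv (outward_normal \<Omega> x) \<eta> (x, t))
          + ((LINT x:\<Omega> - A|lebesgue. u (x, t2) * \<eta> (x, t2))
             - (LINT x:\<Omega> - A|lebesgue. u (x, t1) * \<eta> (x, t1))))"

text \<open>
  Positive solutions in \<open>(\<Omega> - A) \<times> (0, \<infinity>)\<close> with boundary values \<open>f\<close> on \<open>\<partial>\<Omega> \<times> (0, \<infinity>)\<close> and initial
  values \<open>g\<close>, where no condition is imposed at the removed points \<open>A\<close>.
\<close>

definition dirichlet_solution ::
  "real \<Rightarrow> 'a::euclidean_space set \<Rightarrow> 'a set \<Rightarrow> ('a \<times> real \<Rightarrow> real) \<Rightarrow> ('a \<Rightarrow> real)
    \<Rightarrow> ('a \<times> real \<Rightarrow> real) \<Rightarrow> bool" where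
  "dirichlet_solution m \<Omega> A f g u \<longleftrightarrow>
     (\<forall>z\<in>(\<Omega> - A) \<times> {0<..}. 0 < u z) \<and>
     C21_on ((\<Omega> - A) \<times> {0<..}) u \<and>
     (\<forall>z\<in>(\<Omega> - A) \<times> {0<..}. time_deriv u z = space_laplacian (\<lambda>y. u y powr m) z) \<and>
     (\<forall>K. compact K \<longrightarrow> K \<subseteq> \<Omega> - A \<longrightarrow>
        ((\<lambda>t. LINT x:K|lebesgue. \<bar>u (x, t) - g x\<bar>) \<longlongrightarrow> 0) (at_right 0)) \<and>
     weak_identity m \<Omega> A f u"

definition blowup_solution ::
  "real \<Rightarrow> 'a::euclidean_space set \<Rightarrow> 'a set \<Rightarrow> ('a \<times> real \<Rightarrow> real) \<Rightarrow> ('a \<Rightarrow> real)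
    \<Rightarrow> ('a \<times> real \<Rightarrow> real) \<Rightarrow> bool" where
  "blowup_solution m \<Omega> A f u\<^sub>0 u \<longleftrightarrow>
     dirichlet_solution m \<Omega> A f u\<^sub>0 u \<and>
     (\<forall>a\<in>A. \<forall>t>0. filterlim (\<lambda>x. u (x, t)) at_top (at a))"

definition approx_solution ::
  "real \<Rightarrow> 'a::euclidean_space set \<Rightarrow> ('a \<times> real \<Rightarrow> real) \<Rightarrow> ('a \<Rightarrow> real) \<Rightarrow> real \<Rightarrow> real
    \<Rightarrow> ('a \<times> real \<Rightarrow> real) \<Rightarrow> bool" where
  "approx_solution m \<Omega> f u\<^sub>0 \<epsilon> M v \<longleftrightarrow>
     dirichlet_solution m \<Omega> {} (\<lambda>z. f z + \<epsilon>) (\<lambda>x. min (u\<^sub>0 x) M + \<epsilon>) v \<and>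
     (\<forall>z\<in>\<Omega> \<times> {0<..}. \<epsilon> \<le> v z \<and>
        ereal (v z) \<le> max (ereal M) (Linf_norm (lateral_measure \<Omega>) f) + ereal \<epsilon>)"

text \<open>
  \<open>v \<epsilon> M\<close> is the unique approximate solution; uniqueness refers to its values on
  \<open>\<Omega> \<times> (0, \<infinity>)\<close>, since functions here are total. \<open>w M\<close> is the inner limit as \<open>\<epsilon> \<rightarrow> 0\<close>.
\<close>

definition constructed_solution ::
  "real \<Rightarrow> 'a::euclidean_space set \<Rightarrow> 'a set \<Rightarrow> ('a \<times> real \<Rightarrow> real) \<Rightarrow> ('a \<Rightarrow> real)
    \<Rightarrow> ('a \<times> real \<Rightarrow> real) \<Rightarrow> bool" where
  "constructed_solution m \<Omega> A f u\<^sub>0 u \<longleftrightarrow>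
     blowup_solution m \<Omega> A f u\<^sub>0 u \<and>
     (\<exists>v w.
        (\<forall>\<epsilon> M. 0 < \<epsilon> \<longrightarrow> \<epsilon> < 1 \<longrightarrow> 0 < M \<longrightarrow>
           approx_solution m \<Omega> f u\<^sub>0 \<epsilon> M (v \<epsilon> M) \<and>
           (\<forall>v'. approx_solution m \<Omega> f u\<^sub>0 \<epsilon> M v' \<longrightarrow>
              (\<forall>z\<in>\<Omega> \<times> {0<..}. v' z = v \<epsilon> M z))) \<and>
        (\<forall>M>0. \<forall>z\<in>(\<Omega> - A) \<times> {0<..}. ((\<lambda>\<epsilon>. v \<epsilon> M z) \<longlongrightarrow> w M z) (at_right 0)) \<and>
        (\<forall>z\<in>(\<Omega> - A) \<times> {0<..}. ((\<lambda>M. w M z) \<longlongrightarrow> u z) at_top))"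

end

theory Submission
  imports Defs
begin

text \<open>
  Only the singularity of \<open>u\<^sub>0\<close> at \<open>a\<^sub>1\<close> and positivity of \<open>u\<close> drive the growth. Put \<open>\<beta> = m \<gamma>\<^sub>1 > n - 2\<close> and
  \<open>y = a\<^sub>1\<close>. As \<open>\<beta> (1 - m) / m > 2\<close>, the function \<open>k ((\<bar>x - y\<bar>\<^sup>2 + s\<^sub>0 e\<^bsup>c t\<^esup>)\<^bsup>-\<beta>/2\<^esup> - \<rho>\<^bsup>-\<beta>\<^esup>)\<^sub>+\<close> is the \<open>m\<close>-th power of a
  subsolution as long as \<open>s\<^sub>0 e\<^bsup>c t\<^esup>\<close> is small. It is bounded and compactly supported, so it lies below
  \<open>u\<^sub>\<epsilon>\<^sub>,\<^sub>M\<close> once \<open>M\<close> is large, whatever the boundary values are. Letting \<open>M \<rightarrow> \<infinity>\<close> and \<open>s\<^sub>0 \<rightarrow> 0\<close> gives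
  \<open>u\<^sup>m \<ge> k (\<bar>x - y\<bar>\<^bsup>-\<beta>\<^esup> - \<rho>\<^bsup>-\<beta>\<^esup>)\<close> near \<open>y\<close> for all times.

  By the classical minimum principle, a bound \<open>u\<^sup>m \<ge> H\<close> on a sphere of radius \<open>r\<close> for all large times
  propagates outwards to \<open>u\<^sup>m \<ge> H r\<^sup>b (\<bar>x - y\<bar>\<^bsup>-b\<^esup> - R\<^bsup>-b\<^esup>)\<close> for all larger times, for any \<open>b > n - 2\<close>. With
  \<open>n - 2 < b < \<beta>\<close> and \<open>H \<approx> k r\<^bsup>-\<beta>\<^esup>\<close>, letting \<open>r \<rightarrow> 0\<close> shows that \<open>u \<rightarrow> \<infinity>\<close> locally uniformly somewhere near \<open>y\<close>;
  the same propagation along balls makes the set of such points open and closed in the connected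
  set \<open>\<Omega> - {a\<^sub>1, \<dots>}\<close>.
\<close>

section \<open>One-variable calculus and integration by parts\<close>

text \<open>At 0 the difference quotient is dominated by \<open>\<bar>h\<bar> powr (p - 1)\<close>,
  which tends to 0 as \<open>p > 1\<close>. Positive parts can therefore be differentiated
  classically in the energy argument.\<close>

lemma has_real_derivative_max_powr:
  fixes s p :: real
  assumes "1 < p"
  shows "((\<lambda>s. max 0 s powr p) has_real_derivative p * max 0 s powr (p - 1)) (at s)"
proof -
  consider "s < 0" | "s = 0" | "0 < s" by linarith
  then show ?thesis
  proof cases
    case 1
    have "((\<lambda>s. 0) has_real_derivative p * max 0 s powr (p - 1)) (at s)"
      using 1 by auto
    then show ?thesis
      by (rule has_field_derivative_transform_within_open[where S = "{..<0}"]) (use 1 in auto)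
  next
    case 2
    have "((\<lambda>h::real. \<bar>h\<bar> powr (p - 1)) \<longlongrightarrow> \<bar>0\<bar> powr (p - 1)) (at 0)"
      by (rule tendsto_powr') (use assms in \<open>auto intro!: tendsto_rabs_zero tendsto_ident_at\<close>)
    then have "((\<lambda>h::real. \<bar>h\<bar> powr (p - 1)) \<longlongrightarrow> 0) (at 0)" by simp
    then have "((\<lambda>h. max 0 h powr p / h) \<longlongrightarrow> 0) (at 0)"
    proof (rule Lim_null_comparison[rotated])
      show "\<forall>\<^sub>F h in at 0. norm (max 0 h powr p / h) \<le> \<bar>h\<bar> powr (p - 1)"
        by (rule eventuallyI) (auto simp: max_def powr_diff intro: divide_nonneg_nonpos)
    qed
    then show ?thesis
      using 2 assms by (simp add: DERIV_def)
  next
    case 3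
    have "((\<lambda>s. s powr p) has_real_derivative p * s powr (p - 1)) (at s)"
      using 3 by (auto intro!: derivative_eq_intros)
    then have "((\<lambda>s. s powr p) has_real_derivative p * max 0 s powr (p - 1)) (at s)"
      using 3 by simp
    then show ?thesis
      by (rule has_field_derivative_transform_within_open[where S = "{0<..}"]) (use 3 in auto)
  qed
qed

lemma has_real_derivative_max_power:
  fixes s :: real
  assumes "2 \<le> n"
  shows "((\<lambda>s. max 0 s ^ n) has_real_derivative real n * max 0 s ^ (n - 1)) (at s)"
proof -
  \<comment> \<open>At base 0, \<open>powr\<close> returns 0 for every exponent while
    \<open>0 ^ 0 = 1\<close>, hence the restriction \<open>0 < j\<close>. The identity is used at
    \<open>n\<close> and \<open>n - 1\<close>.\<close>
  have *: "max 0 s powr real j = max 0 s ^ j" if "0 < j" for s :: real and j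
  proof (cases "0 < s")
    case True
    then show ?thesis by (simp only: max.absorb2 less_imp_le powr_realpow)
  next
    case False
    then have "max 0 s = 0" by simp
    then show ?thesis using that by simp
  qed
  have "((\<lambda>s. max 0 s powr real n) has_real_derivative real n * max 0 s powr (real n - 1)) (at s)"
    by (rule has_real_derivative_max_powr) (use assms in simp)
  moreover have "real n - 1 = real (n - 1)" "0 < n" "0 < n - 1" using assms by auto
  ultimately show ?thesis by (simp only: *)
qed

text \<open>If \<open>l < 0\<close>, then \<open>f'\<close>, which vanishes at the minimum, is
  negative just to the right of 0, and \<open>f\<close> drops below \<open>f 0\<close>.\<close>

lemma second_derivative_nonneg_at_min:
  fixes f f' :: "real \<Rightarrow> real"
  assumes d: "0 < d"
    and f: "\<And>h. \<bar>h\<bar> < d \<Longrightarrow> (f has_real_derivative f' h) (at h)"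
    and f': "(f' has_real_derivative l) (at 0)"
    and min: "\<And>h. \<bar>h\<bar> < d \<Longrightarrow> f 0 \<le> f h"
  shows "0 \<le> l"
proof (rule ccontr)
  assume "\<not> 0 \<le> l"
  then obtain e where e: "0 < e" "\<And>h. 0 < h \<Longrightarrow> h < e \<Longrightarrow> f' (0 + h) < f' 0"
    using DERIV_neg_dec_right[OF f'] by (meson not_le)
  have "f' 0 = 0"
    by (rule DERIV_local_min[of f "f' 0" 0 d]) (use f[of 0] d min in auto)
  define h where "h = min d e / 2"
  have h: "0 < h" "h < d" "h < e" using d e by (auto simp: h_def)
  have "f h < f 0"
  proof (rule DERIV_neg_imp_decreasing_open[OF h(1)])
    fix x assume "0 < x" "x < h"
    then show "\<exists>y. (f has_real_derivative y) (at x) \<and> y < 0"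
      using f[of x] e(2)[of x] h \<open>f' 0 = 0\<close> by (intro exI[of _ "f' x"]) auto
  next
    show "continuous_on {0..h} f"
      using h by (intro continuous_at_imp_continuous_on ballI DERIV_isCont[OF f]) auto
  qed
  then show False using min[of h] h by auto
qed

text \<open>Only earlier times are compared, because the minimum over a space-time cylinder may be
  attained at its final time.\<close>

lemma derivative_nonpos_at_left_min:
  fixes f :: "real \<Rightarrow> real"
  assumes f: "(f has_real_derivative l) (at t)" and "s < t"
    and min: "\<And>r. s \<le> r \<Longrightarrow> r \<le> t \<Longrightarrow> f t \<le> f r"
  shows "l \<le> 0"
proof (rule ccontr)
  assume "\<not> l \<le> 0"
  then obtain e where e: "0 < e" "\<And>h. 0 < h \<Longrightarrow> h < e \<Longrightarrow> f (t - h) < f t"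
    using DERIV_pos_inc_left[OF f] by (meson not_le)
  define h where "h = min e (t - s) / 2"
  have "0 < h" "h < e" "h \<le> t - s" using e \<open>s < t\<close> by (auto simp: h_def)
  then show False using e(2)[of h] min[of "t - h"] by auto
qed

text \<open>The integral of a compactly supported function is invariant under translation.\<close>

lemma integral_directional_derivative_eq_0:
  fixes F F' :: "'a::euclidean_space \<Rightarrow> real"
  assumes der: "\<And>x. ((\<lambda>h. F (x + h *\<^sub>R i)) has_real_derivative F' x) (at 0)"
    and contF: "continuous_on UNIV F" and contF': "continuous_on UNIV F'"
    and supp: "\<And>x. x \<notin> cbox a b \<Longrightarrow> F x = 0"
  shows "integral (cbox a b) F' = 0"
proof -
  \<comment> \<open>All translates of the box by multiples of \<open>i\<close> with coefficient in
    [-1, 1] fit into one fixed box, so the domain of integration does not depend on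
    \<open>h\<close>.\<close>
  define K where "K = (\<lambda>(x, h). x - h *\<^sub>R i) ` (cbox a b \<times> {-1..1::real})"
  have "compact K"
    unfolding K_def
    by (intro compact_continuous_image continuous_intros compact_Times) (auto simp: split_def intro!: continuous_intros)
  then obtain c where c: "K \<subseteq> cbox (-c) c"
    using bounded_subset_cbox_symmetric compact_imp_bounded by blast
  have sub: "x - h *\<^sub>R i \<in> cbox (-c) c" if "x \<in> cbox a b" "\<bar>h\<bar> \<le> 1" for x h
  proof -
    have "x - h *\<^sub>R i \<in> K"
      unfolding K_def using that by (intro image_eqI[of _ _ "(x, h)"]) auto
    then show ?thesis using c by blast
  qed
  have F'0: "F' x = 0" if "x \<notin> cbox a b" for x
  proof -
    have "open ((\<lambda>h::real. x + h *\<^sub>R i) -` (- cbox a b))"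
      by (intro open_vimage continuous_intros) auto
    then have "((\<lambda>h. 0) has_real_derivative F' x) (at 0)"
      by (intro has_field_derivative_transform_within_open[OF der[of x]]) (use that supp in auto)
    then show ?thesis using DERIV_unique DERIV_const by blast
  qed
  have lineder: "((\<lambda>h. F (x + h *\<^sub>R i)) has_real_derivative F' (x + h *\<^sub>R i)) (at h)" for x h
    using der[of "x + h *\<^sub>R i"] DERIV_shift[of "\<lambda>h. F (x + h *\<^sub>R i)" _ 0 h]
    by (simp add: algebra_simps)
  define I where "I = integral (cbox a b) F"
  have const: "integral (cbox (-c) c) (\<lambda>x. F (x + h *\<^sub>R i)) = I" if h: "\<bar>h\<bar> \<le> 1" for h
  proof -
    have "(F has_integral I) (cbox a b)"
      unfolding I_def
      by (intro integrable_integral integrable_continuous continuous_on_subset[OF contF]) auto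
    moreover have "cbox a b = cbox ((a - h *\<^sub>R i) + h *\<^sub>R i) ((b - h *\<^sub>R i) + h *\<^sub>R i)" by simp
    ultimately have "((F \<circ> ((+) (h *\<^sub>R i))) has_integral I) (cbox (a - h *\<^sub>R i) (b - h *\<^sub>R i))"
      using has_integral_shift_cbox_iff by metis
    then have "((\<lambda>x. F (x + h *\<^sub>R i)) has_integral I) (cbox (a - h *\<^sub>R i) (b - h *\<^sub>R i))"
      by (simp add: o_def add.commute)
    then have "((\<lambda>x. F (x + h *\<^sub>R i)) has_integral I) (cbox (-c) c)"
    proof (rule has_integral_on_superset)
      fix x assume x: "x \<notin> cbox (a - h *\<^sub>R i) (b - h *\<^sub>R i)"
      then have "x + h *\<^sub>R i \<notin> cbox a b" by (auto simp: mem_box algebra_simps)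
      then show "F (x + h *\<^sub>R i) = 0" by (rule supp)
    next
      show "cbox (a - h *\<^sub>R i) (b - h *\<^sub>R i) \<subseteq> cbox (-c) c"
      proof
        fix x assume "x \<in> cbox (a - h *\<^sub>R i) (b - h *\<^sub>R i)"
        then have "x + h *\<^sub>R i \<in> cbox a b" by (auto simp: mem_box algebra_simps)
        then show "x \<in> cbox (-c) c" using sub[of "x + h *\<^sub>R i" h] h by simp
      qed
    qed
    then show ?thesis by (rule integral_unique)
  qed
  \<comment> \<open>Differentiation under the integral sign gives the integral of \<open>F'\<close>,
    whereas by \<open>const\<close> the function being differentiated is constant near 0.\<close>
  have "((\<lambda>h. integral (cbox (-c) c) (\<lambda>x. F (x + h *\<^sub>R i))) has_real_derivative
      integral (cbox (-c) c) (\<lambda>x. F' (x + 0 *\<^sub>R i))) (at 0 within {-1<..<1})"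
  proof (rule leibniz_rule_field_derivative)
    show "continuous_on ({-1<..<1} \<times> cbox (-c) c) (\<lambda>(h::real, x). F' (x + h *\<^sub>R i))"
      unfolding split_def
      by (intro continuous_on_compose2[OF contF'] continuous_intros) auto
    show "(\<lambda>x. F (x + h *\<^sub>R i)) integrable_on cbox (-c) c" for h
      by (intro integrable_continuous continuous_on_compose2[OF contF] continuous_intros) auto
  qed (auto intro: has_field_derivative_at_within lineder)
  then have "((\<lambda>h. integral (cbox (-c) c) (\<lambda>x. F (x + h *\<^sub>R i))) has_real_derivative
      integral (cbox (-c) c) F') (at 0)"
    using at_within_open[of 0 "{-1<..<1::real}"] by simp
  then have "((\<lambda>h. I) has_real_derivative integral (cbox (-c) c) F') (at 0)"
    by (rule has_field_derivative_transform_within_open[where S = "{-1<..<1}"]) (use const in auto)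
  then have "integral (cbox (-c) c) F' = 0" using DERIV_unique DERIV_const by blast
  moreover have "integral (cbox (-c) c) F' = integral (cbox a b) F'"
  proof -
    have "(F' has_integral integral (cbox a b) F') (cbox a b)"
      by (intro integrable_integral integrable_continuous continuous_on_subset[OF contF']) auto
    then have "(F' has_integral integral (cbox a b) F') (cbox (-c) c)"
      by (rule has_integral_on_superset) (use F'0 sub[of _ 0] in auto)
    then show ?thesis by (rule integral_unique)
  qed
  ultimately show ?thesis by simp
qed

text \<open>\<open>F\<close> is extended by zero. The open sets \<open>box a b\<close> and
  \<open>- K\<close> cover the space; the extension is \<open>F\<close> on the first and 0 on the
  second, so it inherits the regularity of \<open>F\<close>.\<close>

lemma integral_directional_derivative_eq_0_local:
  fixes F F' :: "'a::euclidean_space \<Rightarrow> real"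
  assumes W: "open W" "cbox a b \<subseteq> W" and K: "closed K" "K \<subseteq> box a b"
    and der: "\<And>x. x \<in> W \<Longrightarrow> ((\<lambda>h. F (x + h *\<^sub>R i)) has_real_derivative F' x) (at 0)"
    and contF: "continuous_on W F" and contF': "continuous_on W F'"
    and supp: "\<And>x. x \<in> W \<Longrightarrow> x \<notin> K \<Longrightarrow> F x = 0"
  shows "integral (cbox a b) F' = 0"
proof -
  define G where "G = (\<lambda>x. if x \<in> box a b then F x else 0)"
  define G' where "G' = (\<lambda>x. if x \<in> box a b then F' x else 0)"
  have bW: "box a b \<subseteq> W" using W box_subset_cbox by blast
  have openK: "open (- K)" using K by auto
  have line_open: "open ((\<lambda>h::real. x + h *\<^sub>R i) -` T)" if "open T" for T x
    by (intro open_vimage continuous_intros that)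
  have F'0: "F' x = 0" if "x \<in> W" "x \<notin> K" for x
  proof -
    have "((\<lambda>h. 0) has_real_derivative F' x) (at 0)"
      by (intro has_field_derivative_transform_within_open[OF der[OF that(1)] line_open[of "W - K" x]])
         (use that supp W K in auto)
    then show ?thesis using DERIV_unique DERIV_const by blast
  qed
  have UN: "UNIV = box a b \<union> (- K)" using K by auto
  have "integral (cbox a b) G' = 0"
  proof (rule integral_directional_derivative_eq_0)
    fix x
    show "((\<lambda>h. G (x + h *\<^sub>R i)) has_real_derivative G' x) (at 0)"
    proof (cases "x \<in> box a b")
      case True
      then have "((\<lambda>h. F (x + h *\<^sub>R i)) has_real_derivative G' x) (at 0)"
        using der bW by (auto simp: G'_def)
      then show ?thesis
        by (rule has_field_derivative_transform_within_open[OF _ line_open[of "box a b" x]])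
           (use True in \<open>auto simp: G_def\<close>)
    next
      case False
      then have "((\<lambda>h. 0) has_real_derivative G' x) (at 0)" by (simp add: G'_def)
      then show ?thesis
        by (rule has_field_derivative_transform_within_open[OF _ line_open[OF openK, of x]])
           (use False K supp bW in \<open>auto simp: G_def\<close>)
    qed
  next
    have "continuous_on (box a b) G"
      by (rule continuous_on_eq[OF continuous_on_subset[OF contF bW]]) (auto simp: G_def)
    moreover have "continuous_on (- K) G"
      by (rule continuous_on_eq[of _ "\<lambda>x. 0"]) (use supp bW in \<open>auto simp: G_def\<close>)
    ultimately show "continuous_on UNIV G"
      unfolding UN by (intro continuous_on_open_Un openK) auto
    have "continuous_on (box a b) G'"
      by (rule continuous_on_eq[OF continuous_on_subset[OF contF' bW]]) (auto simp: G'_def)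
    moreover have "continuous_on (- K) G'"
      by (rule continuous_on_eq[of _ "\<lambda>x. 0"]) (use F'0 bW in \<open>auto simp: G'_def\<close>)
    ultimately show "continuous_on UNIV G'"
      unfolding UN by (intro continuous_on_open_Un openK) auto
    show "G x = 0" if "x \<notin> cbox a b" for x
      using that box_subset_cbox[of a b] by (auto simp: G_def)
  qed
  moreover have "G' x = F' x" if "x \<in> cbox a b" for x
    using that F'0[of x] W K by (auto simp: G'_def)
  ultimately show ?thesis
    by (metis (no_types, lifting) integral_cong)
qed

section \<open>Classical positive solutions\<close>

lemma has_real_derivative_along_line:
  fixes f :: "'a::real_normed_vector \<Rightarrow> real"
  assumes "(f has_derivative f') (at x)"
  shows "((\<lambda>h. f (x + h *\<^sub>R i)) has_real_derivative f' i) (at 0)"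
proof -
  have "((\<lambda>h. x + h *\<^sub>R i) has_derivative (\<lambda>h. h *\<^sub>R i)) (at (0::real))"
    by (auto intro!: derivative_eq_intros)
  then have "((\<lambda>h. f (x + h *\<^sub>R i)) has_derivative (\<lambda>h. f' (h *\<^sub>R i))) (at (0::real))"
    using has_derivative_compose[of "\<lambda>h. x + h *\<^sub>R i" "\<lambda>h. h *\<^sub>R i" 0 UNIV f f'] assms by simp
  moreover have "f' (h *\<^sub>R i) = f' i * h" for h
    using linear_scale[OF has_derivative_linear[OF assms]] by simp
  ultimately show ?thesis by (simp add: has_field_derivative_def)
qed

lemma has_real_derivative_line_shift:
  fixes f f' :: "'a::real_normed_vector \<Rightarrow> real"
  assumes "((\<lambda>h. f ((x + k *\<^sub>R i) + h *\<^sub>R i)) has_real_derivative l) (at 0)"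
  shows "((\<lambda>h. f (x + h *\<^sub>R i)) has_real_derivative l) (at k)"
  using assms DERIV_shift[of "\<lambda>h. f (x + h *\<^sub>R i)" l 0 k] by (simp add: algebra_simps)

text \<open>\<open>v1 i\<close> and \<open>v2 i\<close> are the first and second derivatives of
  \<open>u powr m\<close> along \<open>i\<close>. Boundary and initial data are left out, so the
  locale applies both to the approximations on \<open>\<Omega>\<close> and to their limit on the
  punctured domain.\<close>

locale fde_solution =
  fixes m :: real and S :: "'a::euclidean_space set" and u ut :: "'a \<times> real \<Rightarrow> real"
    and v1 v2 :: "'a \<Rightarrow> 'a \<times> real \<Rightarrow> real"
  assumes m_pos: "0 < m" and m_less: "m < 1" and open_S: "open S"
    and u_pos: "\<And>x t. x \<in> S \<Longrightarrow> 0 < t \<Longrightarrow> 0 < u (x, t)"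
    and cont_u: "continuous_on (S \<times> {0<..}) u"
    and cont_ut: "continuous_on (S \<times> {0<..}) ut"
    and cont_v1: "\<And>i. i \<in> Basis \<Longrightarrow> continuous_on (S \<times> {0<..}) (v1 i)"
    and cont_v2: "\<And>i. i \<in> Basis \<Longrightarrow> continuous_on (S \<times> {0<..}) (v2 i)"
    and deriv_t: "\<And>x t. x \<in> S \<Longrightarrow> 0 < t \<Longrightarrow> ((\<lambda>s. u (x, s)) has_real_derivative ut (x, t)) (at t)"
    and deriv_x: "\<And>i x t. i \<in> Basis \<Longrightarrow> x \<in> S \<Longrightarrow> 0 < t \<Longrightarrow>
        ((\<lambda>h. u (x + h *\<^sub>R i, t) powr m) has_real_derivative v1 i (x, t)) (at 0)"
    and deriv_xx: "\<And>i x t. i \<in> Basis \<Longrightarrow> x \<in> S \<Longrightarrow> 0 < t \<Longrightarrow>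
        ((\<lambda>h. v1 i (x + h *\<^sub>R i, t)) has_real_derivative v2 i (x, t)) (at 0)"
    and pde: "\<And>x t. x \<in> S \<Longrightarrow> 0 < t \<Longrightarrow> ut (x, t) = (\<Sum>i\<in>Basis. v2 i (x, t))"

text \<open>Regularity is given for \<open>u\<close>, the equation for \<open>u powr m\<close>;
  positivity permits the chain rule that links them.\<close>

lemma fde_solution_dirichlet_solution:
  fixes \<Omega> :: "'a::euclidean_space set"
  assumes sol: "dirichlet_solution m \<Omega> A f g u" and op: "open (\<Omega> - A)" and m: "0 < m" "m < 1"
  obtains v1 v2 where "fde_solution m (\<Omega> - A) u (time_deriv u) v1 v2"
proof -
  let ?D = "(\<Omega> - A) \<times> {0<..}"
  define v1 where "v1 i z = m * u z powr (m - 1) * space_deriv i u z" for i and z :: "'a \<times> real"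
  define v2 where "v2 i z = m * (m - 1) * u z powr (m - 2) * (space_deriv i u z)\<^sup>2
      + m * u z powr (m - 1) * space_deriv i (space_deriv i u) z" for i and z :: "'a \<times> real"
  have pos: "0 < u (x, t)" if "x \<in> \<Omega> - A" "0 < t" for x t
    using sol that by (auto simp: dirichlet_solution_def)
  have C: "C21_on ?D u" and eq: "\<forall>z\<in>?D. time_deriv u z = space_laplacian (\<lambda>y. u y powr m) z"
    using sol by (auto simp: dirichlet_solution_def)
  have cu: "continuous_on ?D u" and cut: "continuous_on ?D (time_deriv u)"
    and c1: "\<And>i. i \<in> Basis \<Longrightarrow> continuous_on ?D (space_deriv i u)"
    and c2: "\<And>i. i \<in> Basis \<Longrightarrow> continuous_on ?D (space_deriv i (space_deriv i u))"
    using C by (auto simp: C21_on_def)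
  have dt: "(\<lambda>s. u (x, s)) differentiable (at t)"
    and dx: "(\<lambda>y. u (y, t)) differentiable (at x)"
    and dxx: "\<And>i. i \<in> Basis \<Longrightarrow> (\<lambda>y. space_deriv i u (y, t)) differentiable (at x)"
    if "x \<in> \<Omega> - A" "0 < t" for x t
    using C that by (auto simp: C21_on_def)
  have d1: "((\<lambda>y. u (y, t) powr m) has_derivative
      (\<lambda>h. m * u (x, t) powr (m - 1) * frechet_derivative (\<lambda>y. u (y, t)) (at x) h)) (at x)"
    if "x \<in> \<Omega> - A" "0 < t" for x t
  proof -
    have "((\<lambda>y. u (y, t)) has_derivative frechet_derivative (\<lambda>y. u (y, t)) (at x)) (at x)"
      using dx[OF that] frechet_derivative_works by blast
    moreover have "((\<lambda>s. s powr m) has_derivative (\<lambda>h. m * u (x, t) powr (m - 1) * h)) (at (u (x, t)))"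
      using has_real_derivative_powr[OF pos[OF that], of m] by (simp add: has_field_derivative_def)
    ultimately show ?thesis
      using has_derivative_compose[of "\<lambda>y. u (y, t)" _ x UNIV "\<lambda>s. s powr m"] by simp
  qed
  have dd1: "dir_deriv i (\<lambda>y. u (y, t) powr m) x = v1 i (x, t)" if "x \<in> \<Omega> - A" "0 < t" for i x t
    using frechet_derivative_at[OF d1[OF that]]
    by (simp add: dir_deriv_def v1_def space_deriv_def fun_eq_iff)
  have d2: "\<exists>G. ((\<lambda>y. v1 i (y, t)) has_derivative G) (at x) \<and> G i = v2 i (x, t)"
    if "x \<in> \<Omega> - A" "0 < t" "i \<in> Basis" for i x t
  proof -
    let ?F = "frechet_derivative (\<lambda>y. u (y, t)) (at x)"
    let ?G = "frechet_derivative (\<lambda>y. space_deriv i u (y, t)) (at x)"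
    have F: "((\<lambda>y. u (y, t)) has_derivative ?F) (at x)"
      using dx[OF that(1,2)] frechet_derivative_works by blast
    have G: "((\<lambda>y. space_deriv i u (y, t)) has_derivative ?G) (at x)"
      using dxx[OF that] frechet_derivative_works by blast
    have "((\<lambda>s. s powr (m - 1)) has_derivative (\<lambda>h. (m - 1) * u (x, t) powr (m - 1 - 1) * h)) (at (u (x, t)))"
      using has_real_derivative_powr[OF pos[OF that(1,2)], of "m - 1"] by (simp add: has_field_derivative_def)
    from has_derivative_compose[OF F this]
    have P: "((\<lambda>y. u (y, t) powr (m - 1)) has_derivative
        (\<lambda>h. (m - 1) * u (x, t) powr (m - 1 - 1) * ?F h)) (at x)" .
    have "((\<lambda>y. m * u (y, t) powr (m - 1) * space_deriv i u (y, t)) has_derivative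
        (\<lambda>h. m * u (x, t) powr (m - 1) * ?G h + m * ((m - 1) * u (x, t) powr (m - 1 - 1) * ?F h) * space_deriv i u (x, t)))
        (at x)"
      by (rule has_derivative_mult[OF has_derivative_mult_right[OF P] G])
    then show ?thesis
      unfolding v1_def v2_def
      by (intro exI conjI) (assumption, simp add: space_deriv_def dir_deriv_def power2_eq_square algebra_simps)
  qed
  have dd2: "dir_deriv i (dir_deriv i (\<lambda>y. u (y, t) powr m)) x = v2 i (x, t)"
    if xt: "x \<in> \<Omega> - A" "0 < t" "i \<in> Basis" for i x t
  proof -
    obtain G where G: "((\<lambda>y. v1 i (y, t)) has_derivative G) (at x)" "G i = v2 i (x, t)"
      using d2[OF xt] by blast
    \<comment> \<open>\<open>dd1\<close> holds throughout the open set \<open>\<Omega> - A\<close>,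
      so both of its sides can be differentiated once more.\<close>
    have "(dir_deriv i (\<lambda>y. u (y, t) powr m) has_derivative G) (at x)"
      by (rule has_derivative_transform_within_open[OF G(1) op xt(1)]) (simp add: dd1 xt)
    then show ?thesis
      using frechet_derivative_at G(2) by (metis dir_deriv_def)
  qed
  show ?thesis
  proof
    show "fde_solution m (\<Omega> - A) u (time_deriv u) v1 v2"
    proof
      fix i x t assume xt: "(i::'a) \<in> Basis" "x \<in> \<Omega> - A" "0 < (t::real)"
      show "((\<lambda>h. u (x + h *\<^sub>R i, t) powr m) has_real_derivative v1 i (x, t)) (at 0)"
        using has_real_derivative_along_line[OF d1[OF xt(2,3)], of i]
        by (simp add: v1_def space_deriv_def dir_deriv_def)
      show "((\<lambda>h. v1 i (x + h *\<^sub>R i, t)) has_real_derivative v2 i (x, t)) (at 0)"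
        using d2[OF xt(2,3,1)] has_real_derivative_along_line[of "\<lambda>y. v1 i (y, t)" _ x i] by metis
    next
      fix x t assume xt: "x \<in> \<Omega> - A" "0 < (t::real)"
      show "((\<lambda>s. u (x, s)) has_real_derivative time_deriv u (x, t)) (at t)"
        using dt[OF xt] by (simp add: time_deriv_def DERIV_deriv_iff_real_differentiable)
      show "time_deriv u (x, t) = (\<Sum>i\<in>Basis. v2 i (x, t))"
        using eq xt by (simp add: space_laplacian_def laplacian_def dd2)
    next
      fix i :: 'a assume i: "i \<in> Basis"
      have nz: "\<forall>z\<in>?D. u z \<noteq> 0" using pos by force
      show "continuous_on ?D (v1 i)"
        unfolding v1_def by (intro continuous_intros cu c1 i nz)
      show "continuous_on ?D (v2 i)"
        unfolding v2_def by (intro continuous_intros cu c1 c2 i nz)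
    qed (use m op pos cu cut in auto)
  qed
qed

section \<open>Powers of the shifted squared distance and their Laplacian\<close>

lemma has_real_derivative_radial_powr:
  fixes x y i :: "'a::real_inner" and s e :: real
  assumes "0 < (x - y) \<bullet> (x - y) + s"
  shows "((\<lambda>h. ((x + h *\<^sub>R i - y) \<bullet> (x + h *\<^sub>R i - y) + s) powr e) has_real_derivative
           2 * e * ((x - y) \<bullet> (x - y) + s) powr (e - 1) * ((x - y) \<bullet> i)) (at 0)"
proof -
  have 1: "((\<lambda>h. (x + h *\<^sub>R i - y) \<bullet> (x + h *\<^sub>R i - y) + s) has_real_derivative 2 * ((x - y) \<bullet> i)) (at 0)"
    by (auto intro!: derivative_eq_intros simp: inner_diff_left inner_diff_right inner_add_left inner_add_right
        has_field_derivative_def inner_commute algebra_simps fun_eq_iff)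
  show ?thesis
    using DERIV_chain2[OF has_real_derivative_powr 1, of e] assms by (simp add: mult_ac)
qed

lemma has_real_derivative_radial_powr2:
  fixes x y i :: "'a::real_inner" and s e :: real
  assumes "0 < (x - y) \<bullet> (x - y) + s"
  shows "((\<lambda>h. 2 * e * ((x + h *\<^sub>R i - y) \<bullet> (x + h *\<^sub>R i - y) + s) powr (e - 1) * ((x + h *\<^sub>R i - y) \<bullet> i)) has_real_derivative
           4 * e * (e - 1) * ((x - y) \<bullet> (x - y) + s) powr (e - 2) * ((x - y) \<bullet> i)\<^sup>2
           + 2 * e * ((x - y) \<bullet> (x - y) + s) powr (e - 1) * (i \<bullet> i)) (at 0)"
proof -
  have 1: "((\<lambda>h. (x + h *\<^sub>R i - y) \<bullet> i) has_real_derivative i \<bullet> i) (at 0)"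
    by (auto intro!: derivative_eq_intros simp: has_field_derivative_def fun_eq_iff)
  show ?thesis
    by (rule derivative_eq_intros has_real_derivative_radial_powr 1 assms refl)+
       (simp add: power2_eq_square algebra_simps)
qed

lemma powr_diff_two_mult:
  fixes x e :: real
  assumes "0 < x"
  shows "x powr (e - 2) * x = x powr (e - 1)"
  using assms powr_add[of x "e - 2" 1] by (simp add: algebra_simps)

text \<open>For \<open>e = - \<beta> / 2\<close> with \<open>\<beta> > 0\<close> and
  \<open>\<beta> > DIM('a) - 2\<close>, the squared distance contributes nonnegatively and a
  positive \<open>s\<close> negatively. At \<open>s = 0\<close> this is the formula
  \<open>\<beta> (\<beta> + 2 - n) \<bar>x - y\<bar>^(-\<beta> - 2)\<close> in dimension
  \<open>n\<close>.\<close>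

lemma laplacian_radial_powr:
  fixes x y :: "'a::euclidean_space" and s e :: real
  assumes "0 < (x - y) \<bullet> (x - y) + s"
  shows "(\<Sum>i\<in>Basis. 4 * e * (e - 1) * ((x - y) \<bullet> (x - y) + s) powr (e - 2) * ((x - y) \<bullet> i)\<^sup>2
           + 2 * e * ((x - y) \<bullet> (x - y) + s) powr (e - 1) * (i \<bullet> i))
         = 2 * e * ((x - y) \<bullet> (x - y) + s) powr (e - 2) *
           ((2 * e - 2 + DIM('a)) * ((x - y) \<bullet> (x - y)) + DIM('a) * s)"
proof -
  let ?N = "(x - y) \<bullet> (x - y) + s"
  have "?N powr (e - 1) = ?N powr (e - 2) * ?N"
    using assms by (simp add: powr_diff_two_mult)
  moreover have "(\<Sum>i\<in>Basis. ((x - y) \<bullet> i)\<^sup>2) = (x - y) \<bullet> (x - y)"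
    by (subst (2) euclidean_inner) (simp add: power2_eq_square)
  ultimately show ?thesis
    by (simp add: sum.distrib sum_distrib_left[symmetric]) (simp add: algebra_simps)
qed

section \<open>Comparison by an energy estimate\<close>

text \<open>Complete the square in \<open>\<bar>g\<bar>\<close>. The loss is quadratic in
  \<open>c\<close>; in the energy estimate \<open>c\<close> is a multiple of the difference
  \<open>d\<close>, which makes the loss of order \<open>d^2\<close>.\<close>

lemma quadratic_lower_bound:
  fixes A c c0 e g :: real
  assumes "0 < c0" "c0 \<le> A" "\<bar>e\<bar> \<le> c"
  shows "- (c\<^sup>2 / (4 * c0)) \<le> A * g\<^sup>2 + e * g"
proof -
  have "c0 * \<bar>g\<bar>\<^sup>2 - c * \<bar>g\<bar> + c\<^sup>2 / (4 * c0) = c0 * (\<bar>g\<bar> - c / (2 * c0))\<^sup>2"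
    using assms(1) by (simp add: field_simps power2_eq_square)
  then have "0 \<le> c0 * \<bar>g\<bar>\<^sup>2 - c * \<bar>g\<bar> + c\<^sup>2 / (4 * c0)"
    using assms(1) by simp
  moreover have "c0 * \<bar>g\<bar>\<^sup>2 \<le> A * g\<^sup>2"
    using assms(2) by (simp add: mult_right_mono)
  moreover have "\<bar>e * g\<bar> \<le> c * \<bar>g\<bar>"
    using assms(3) by (simp add: abs_mult mult_right_mono)
  ultimately show ?thesis by linarith
qed

text \<open>The derivative of \<open>y powr (1 - m)\<close> decreases in \<open>y\<close>, so its
  value at \<open>\<epsilon>\<close> is a Lipschitz constant for all larger arguments.\<close>

lemma powr_one_minus_lipschitz:
  fixes m \<epsilon> u d :: real
  assumes m: "0 < m" "m < 1" and \<epsilon>: "0 < \<epsilon>" "\<epsilon> \<le> u" and d: "0 \<le> d"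
  shows "\<bar>(u + d) powr (1 - m) - u powr (1 - m)\<bar> \<le> (1 - m) * \<epsilon> powr (- m) * d"
proof -
  let ?f = "\<lambda>y. (1 - m) * \<epsilon> powr (- m) * y - y powr (1 - m)"
  have "?f u \<le> ?f (u + d)"
  proof (rule DERIV_nonneg_imp_nondecreasing[of u "u + d" ?f])
    fix y assume "u \<le> y" "y \<le> u + d"
    then have y: "\<epsilon> \<le> y" "0 < y" using \<epsilon> by auto
    have "(?f has_real_derivative (1 - m) * \<epsilon> powr (- m) - (1 - m) * y powr (- m)) (at y)"
      using y by (auto intro!: derivative_eq_intros)
    moreover have "y powr (- m) \<le> \<epsilon> powr (- m)"
      using y \<epsilon> m by (intro powr_mono2') auto
    then have "0 \<le> (1 - m) * \<epsilon> powr (- m) - (1 - m) * y powr (- m)"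
      using m by (simp add: mult_left_mono)
    ultimately show "\<exists>l. (?f has_real_derivative l) (at y) \<and> 0 \<le> l" by blast
  qed (use d in simp)
  moreover have "u powr (1 - m) \<le> (u + d) powr (1 - m)"
    using assms by (intro powr_mono2) auto
  ultimately show ?thesis by (simp add: algebra_simps)
qed

text \<open>\<open>E t * exp (- (c * t))\<close> is nonincreasing. The initial value enters as a
  one-sided limit because the estimates are available only at positive times.\<close>

lemma gronwall_zero:
  fixes E E' :: "real \<Rightarrow> real"
  assumes der: "\<And>t. 0 < t \<Longrightarrow> t \<le> T \<Longrightarrow> (E has_real_derivative E' t) (at t)"
    and le: "\<And>t. 0 < t \<Longrightarrow> t \<le> T \<Longrightarrow> E' t \<le> c * E t"
    and lim: "(E \<longlongrightarrow> 0) (at_right 0)" and t: "0 < t" "t \<le> T"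
  shows "E t \<le> 0"
proof -
  have "E t * exp (- (c * t)) \<le> E s * exp (- (c * s))" if s: "0 < s" "s < t" for s
  proof (rule DERIV_nonpos_imp_nonincreasing[of s t "\<lambda>t. E t * exp (- (c * t))"])
    fix r assume r: "s \<le> r" "r \<le> t"
    have "((\<lambda>t. E t * exp (- (c * t))) has_real_derivative (E' r - c * E r) * exp (- (c * r))) (at r)"
      using der[of r] r s t by (auto intro!: derivative_eq_intros simp: algebra_simps)
    moreover have "(E' r - c * E r) * exp (- (c * r)) \<le> 0"
      using le[of r] r s t by (intro mult_nonpos_nonneg) auto
    ultimately show "\<exists>y. ((\<lambda>t. E t * exp (- (c * t))) has_real_derivative y) (at r) \<and> y \<le> 0" by blast
  qed (use s in simp)
  then have "\<forall>\<^sub>F s in at_right 0. E t * exp (- (c * t)) \<le> E s * exp (- (c * s))"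
    using t by (auto simp: eventually_at_right)
  moreover have "((\<lambda>s. E s * exp (- (c * s))) \<longlongrightarrow> 0 * exp (- (c * 0))) (at_right 0)"
    by (intro tendsto_intros lim)
  ultimately have "E t * exp (- (c * t)) \<le> 0"
    by (intro tendsto_lowerbound) auto
  then show ?thesis by (simp add: mult_le_0_iff)
qed

context fde_solution
begin

text \<open>The locale records spatial derivatives of \<open>u powr m\<close> only; those of
  \<open>u\<close> follow by writing \<open>u\<close> as the power \<open>1 / m\<close> of
  it.\<close>

lemma deriv_u_along_line:
  assumes "i \<in> Basis" "x \<in> S" "0 < t"
  shows "((\<lambda>h. u (x + h *\<^sub>R i, t)) has_real_derivative (1 / m) * u (x, t) powr (1 - m) * v1 i (x, t)) (at 0)"
proof -
  have inv: "(u (y, t) powr m) powr (1 / m) = u (y, t)" if "y \<in> S" for y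
    using u_pos[OF that assms(3)] m_pos by (simp add: powr_powr)
  have "((\<lambda>h. (u (x + h *\<^sub>R i, t) powr m) powr (1 / m)) has_real_derivative
      (1 / m) * (u (x, t) powr m) powr (1 / m - 1) * v1 i (x, t)) (at 0)"
    using DERIV_chain2[OF has_real_derivative_powr deriv_x[OF assms], of "1 / m"] u_pos[OF assms(2,3)]
    by simp
  moreover have "(u (x, t) powr m) powr (1 / m - 1) = u (x, t) powr (1 - m)"
    using m_pos by (simp add: powr_powr right_diff_distrib)
  moreover have "open ((\<lambda>h::real. x + h *\<^sub>R i) -` S)"
    by (intro open_vimage continuous_intros open_S)
  ultimately show ?thesis
    using has_field_derivative_transform_within_open[of "\<lambda>h. (u (x + h *\<^sub>R i, t) powr m) powr (1 / m)" _ 0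
        "(\<lambda>h::real. x + h *\<^sub>R i) -` S" "\<lambda>h. u (x + h *\<^sub>R i, t)"] inv assms(2) by simp
qed

text \<open>
  With \<open>U = w\<^sub>+\<^bsup>1/m\<^esup>\<close> and \<open>d = U - u\<close>, the energy \<open>\<integral> d\<^sub>+\<^sup>3\<close> satisfies a Gronwall inequality:
  \<open>d\<^sub>t \<le> \<Delta>(w - u\<^sup>m)\<close> where \<open>d > 0\<close>, and after
  integration by parts \<open>\<partial>\<^sub>i d \<partial>\<^sub>i(w - u\<^sup>m)\<close> is bounded below by a multiple of \<open>d\<^sup>2\<close> since \<open>u \<ge> \<epsilon>\<close>.
\<close>

theorem subsolution_le:
  fixes w wt :: "'a \<times> real \<Rightarrow> real" and w1 w2 :: "'a \<Rightarrow> 'a \<times> real \<Rightarrow> real"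
  assumes Q: "cbox a b \<subseteq> S" and K: "closed K" "K \<subseteq> box a b" and ne: "box a b \<noteq> {}"
    and \<epsilon>: "0 < \<epsilon>" and u_ge: "\<And>x t. x \<in> S \<Longrightarrow> 0 < t \<Longrightarrow> \<epsilon> \<le> u (x, t)"
    and cw: "continuous_on (S \<times> {0<..}) w" and cwt: "continuous_on (S \<times> {0<..}) wt"
    and cw1: "\<And>i. i \<in> Basis \<Longrightarrow> continuous_on (S \<times> {0<..}) (w1 i)"
    and cw2: "\<And>i. i \<in> Basis \<Longrightarrow> continuous_on (S \<times> {0<..}) (w2 i)"
    and dwt: "\<And>x t. x \<in> S \<Longrightarrow> 0 < t \<Longrightarrow> ((\<lambda>s. w (x, s)) has_real_derivative wt (x, t)) (at t)"
    and dw1: "\<And>i x t. i \<in> Basis \<Longrightarrow> x \<in> S \<Longrightarrow> 0 < t \<Longrightarrow>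
        ((\<lambda>h. w (x + h *\<^sub>R i, t)) has_real_derivative w1 i (x, t)) (at 0)"
    and dw2: "\<And>i x t. i \<in> Basis \<Longrightarrow> x \<in> S \<Longrightarrow> 0 < t \<Longrightarrow>
        ((\<lambda>h. w1 i (x + h *\<^sub>R i, t)) has_real_derivative w2 i (x, t)) (at 0)"
    and bound: "\<And>i x t. i \<in> Basis \<Longrightarrow> x \<in> cbox a b \<Longrightarrow> 0 < t \<Longrightarrow> t \<le> T \<Longrightarrow> \<bar>w1 i (x, t)\<bar> \<le> B"
    and supp: "\<And>x t. x \<in> S \<Longrightarrow> x \<notin> K \<Longrightarrow> 0 < t \<Longrightarrow> w (x, t) \<le> 0"
    and sub: "\<And>x t. x \<in> cbox a b \<Longrightarrow> 0 < t \<Longrightarrow> t \<le> T \<Longrightarrow> 0 < w (x, t) \<Longrightarrow>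
        (1 / m) * w (x, t) powr (1 / m - 1) * wt (x, t) \<le> (\<Sum>i\<in>Basis. w2 i (x, t))"
    and init: "((\<lambda>t. integral (cbox a b) (\<lambda>x. max 0 (max 0 (w (x, t)) powr (1 / m) - u (x, t)) ^ 3)) \<longlongrightarrow> 0)
        (at_right 0)"
    and x: "x \<in> cbox a b" and t: "0 < t" "t \<le> T"
  shows "w (x, t) \<le> u (x, t) powr m"
proof -
  let ?D = "S \<times> {0<..}"
  let ?Q = "cbox a b"
  define p where "p = 1 / m"
  have p: "1 < p" using m_pos m_less by (simp add: p_def)
  define d where "d z = max 0 (w z) powr p - u z" for z
  define dt where "dt z = p * max 0 (w z) powr (p - 1) * wt z - ut z" for z
  define d1 where "d1 i z = p * max 0 (w z) powr (p - 1) * w1 i z - p * u z powr (1 - m) * v1 i z" for i z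
  \<comment> \<open>\<open>F i\<close> is the flux \<open>d_+^2 \<partial>_i (w - u^m)\<close>. That
    its derivative \<open>F' i\<close> integrates to zero is the integration by parts.\<close>
  define F where "F i z = max 0 (d z) ^ 2 * (w1 i z - v1 i z)" for i z
  define F' where "F' i z = 2 * max 0 (d z) * d1 i z * (w1 i z - v1 i z)
    + max 0 (d z) ^ 2 * (w2 i z - v2 i z)" for i z
  \<comment> \<open>The exponent 3 leaves the weight \<open>max 0 d ^ 2\<close> after
    differentiation in time, and this weight is again differentiable, as the flux requires.\<close>
  define E where "E t = integral ?Q (\<lambda>x. max 0 (d (x, t)) ^ 3)" for t
  define E' where "E' t = integral ?Q (\<lambda>x. 3 * max 0 (d (x, t)) ^ 2 * dt (x, t))" for t
  have nz: "\<forall>z\<in>?D. u z \<noteq> 0" using u_pos by force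
  have cd: "continuous_on ?D d"
    unfolding d_def using p by (intro continuous_intros cw cont_u continuous_on_powr') auto
  have cdt: "continuous_on ?D dt"
    unfolding dt_def using p by (intro continuous_intros cw cwt cont_ut continuous_on_powr') auto
  have cd1: "continuous_on ?D (d1 i)" if "i \<in> Basis" for i
    unfolding d1_def using p that nz
    by (intro continuous_intros cw cw1 cont_u cont_v1 continuous_on_powr') auto
  have cF: "continuous_on ?D (F i)" if "i \<in> Basis" for i
    unfolding F_def using that by (intro continuous_intros cd cw1 cont_v1) auto
  have cF': "continuous_on ?D (F' i)" if "i \<in> Basis" for i
    unfolding F'_def using that by (intro continuous_intros cd cd1 cw1 cw2 cont_v1 cont_v2) auto
  have slice: "continuous_on X (\<lambda>x. h (x, t))" if "continuous_on ?D h" "0 < t" "X \<subseteq> S"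
    for h :: "'a \<times> real \<Rightarrow> real" and t X
    by (rule continuous_on_compose2[OF that(1)]) (use that in \<open>auto intro!: continuous_intros\<close>)
  have ddt: "((\<lambda>s. d (x, s)) has_real_derivative dt (x, t)) (at t)" if "x \<in> S" "0 < t" for x t
    unfolding d_def dt_def
    by (intro DERIV_diff DERIV_chain2[OF has_real_derivative_max_powr[OF p] dwt[OF that]] deriv_t that)
  have dd1: "((\<lambda>h. d (x + h *\<^sub>R i, t)) has_real_derivative d1 i (x, t)) (at 0)"
    if "i \<in> Basis" "x \<in> S" "0 < t" for i x t
  proof -
    have "((\<lambda>h. max 0 (w (x + h *\<^sub>R i, t)) powr p) has_real_derivative
        p * max 0 (w (x, t)) powr (p - 1) * w1 i (x, t)) (at 0)"
      using DERIV_chain2[OF has_real_derivative_max_powr[OF p] dw1[OF that]] by simp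
    then show ?thesis
      unfolding d_def d1_def using deriv_u_along_line[OF that]
      by (intro derivative_intros) (auto simp: p_def)
  qed
  have dF: "((\<lambda>h. F i (x + h *\<^sub>R i, t)) has_real_derivative F' i (x, t)) (at 0)"
    if "i \<in> Basis" "x \<in> S" "0 < t" for i x t
  proof -
    have "((\<lambda>h. max 0 (d (x + h *\<^sub>R i, t)) ^ 2) has_real_derivative 2 * max 0 (d (x, t)) * d1 i (x, t)) (at 0)"
      using DERIV_chain2[OF has_real_derivative_max_power[of 2] dd1[OF that]] by simp
    moreover have "((\<lambda>h. w1 i (x + h *\<^sub>R i, t) - v1 i (x + h *\<^sub>R i, t)) has_real_derivative
        w2 i (x, t) - v2 i (x, t)) (at 0)"
      by (intro derivative_intros dw2 deriv_xx that)
    ultimately show ?thesis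
      unfolding F_def F'_def by (rule DERIV_cong[OF DERIV_mult]) simp
  qed
  have dE: "(E has_real_derivative E' t) (at t)" if t: "0 < t" for t
  proof -
    have "(E has_real_derivative E' t) (at t within {0<..})"
      unfolding E_def[abs_def] E'_def
    proof (rule leibniz_rule_field_derivative)
      fix s :: real and x assume "s \<in> {0<..}" "x \<in> ?Q"
      then have d: "((\<lambda>t. d (x, t)) has_real_derivative dt (x, s)) (at s)" using ddt Q by auto
      have max3: "((\<lambda>y::real. max 0 y ^ 3) has_real_derivative 3 * max 0 y ^ 2) (at y)" for y
        using has_real_derivative_max_power[of 3 y] by simp
      show "((\<lambda>t. max 0 (d (x, t)) ^ 3) has_real_derivative 3 * max 0 (d (x, s)) ^ 2 * dt (x, s)) (at s within {0<..})"
        by (rule has_field_derivative_at_within[OF DERIV_chain2[OF max3 d]])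
    next
      show "(\<lambda>x. max 0 (d (x, s)) ^ 3) integrable_on ?Q" if "s \<in> {0<..}" for s :: real
        using that Q by (intro integrable_continuous continuous_intros slice cd) auto
      have "continuous_on ?D (\<lambda>z. 3 * max 0 (d z) ^ 2 * dt z)"
        by (intro continuous_intros cd cdt)
      then show "continuous_on ({0<..} \<times> ?Q) (\<lambda>(s, x). 3 * max 0 (d (x, s)) ^ 2 * dt (x, s))"
        unfolding split_def
        by (rule continuous_on_compose2[of ?D _ _ "\<lambda>z. (snd z, fst z)", simplified])
           (use Q in \<open>auto intro!: continuous_intros\<close>)
    qed (use t in auto)
    then show ?thesis using t by (simp add: at_within_open[of t "{0<..}"])
  qed
  \<comment> \<open>\<open>c0\<close> bounds the diffusion coefficient
    \<open>p * u powr (1 - m)\<close> from below, \<open>c1 * d\<close> bounds the error from the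
    differing coefficients of \<open>u + d\<close> and \<open>u\<close>, and \<open>L\<close> is the
    loss in \<open>quadratic_lower_bound\<close> with the factor \<open>d^2\<close> removed.\<close>
  define c0 where "c0 = p * \<epsilon> powr (1 - m)"
  define c1 where "c1 = p * ((1 - m) * \<epsilon> powr (- m)) * B"
  define L where "L = c1\<^sup>2 / (4 * c0)"
  have c0: "0 < c0" using p \<epsilon> by (simp add: c0_def)
  have pointwise: "max 0 (d (x, t)) ^ 2 * (w2 i (x, t) - v2 i (x, t)) \<le> F' i (x, t) + 2 * L * max 0 (d (x, t)) ^ 3"
    if i: "i \<in> Basis" and x: "x \<in> ?Q" and t: "0 < t" "t \<le> T" for i x t
  proof (cases "0 < d (x, t)")
    case False
    then have "max 0 (d (x, t)) = 0" by simp
    then show ?thesis by (simp add: F'_def)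
  next
    case True
    define z where "z = (x, t)"
    define g where "g = w1 i z - v1 i z"
    have xS: "x \<in> S" using x Q by auto
    have uz: "\<epsilon> \<le> u z" using u_ge xS t by (simp add: z_def)
    have dz: "0 < d z" using True by (simp add: z_def)
    \<comment> \<open>As \<open>p - 1 = p * (1 - m)\<close>, this factor is the power
      \<open>1 - m\<close> of \<open>u + d\<close>, so the coefficients of both functions have the
      same form.\<close>
    have "max 0 (w z) powr (p - 1) = (max 0 (w z) powr p) powr (1 - m)"
      using m_pos by (simp add: powr_powr p_def field_simps)
    also have "max 0 (w z) powr p = u z + d z" by (simp add: d_def)
    finally have U: "max 0 (w z) powr (p - 1) = (u z + d z) powr (1 - m)" .
    let ?e = "p * ((u z + d z) powr (1 - m) - u z powr (1 - m)) * w1 i z"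
    have eq: "d1 i z * g = p * u z powr (1 - m) * g\<^sup>2 + ?e * g"
      unfolding d1_def U g_def by (simp add: algebra_simps power2_eq_square)
    have "\<bar>?e\<bar> = p * \<bar>(u z + d z) powr (1 - m) - u z powr (1 - m)\<bar> * \<bar>w1 i z\<bar>"
      using p by (simp add: abs_mult)
    also have "\<dots> \<le> p * ((1 - m) * \<epsilon> powr (- m) * d z) * B"
      using powr_one_minus_lipschitz[OF m_pos m_less \<epsilon> uz less_imp_le[OF dz]] bound[OF i x t] p m_less dz
      by (intro mult_mono mult_left_mono mult_nonneg_nonneg) (auto simp: z_def)
    also have "\<dots> = c1 * d z" by (simp add: c1_def)
    finally have e: "\<bar>?e\<bar> \<le> c1 * d z" .
    have A: "c0 \<le> p * u z powr (1 - m)"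
      unfolding c0_def using uz \<epsilon> p m_less by (intro mult_left_mono powr_mono2) auto
    have "- (L * (d z)\<^sup>2) \<le> d1 i z * g"
      using quadratic_lower_bound[OF c0 A e, of g] eq by (simp add: L_def power_mult_distrib)
    then have "2 * d z * (- (L * (d z)\<^sup>2)) \<le> 2 * d z * (d1 i z * g)"
      using dz by (intro mult_left_mono) auto
    then have "0 \<le> 2 * d z * d1 i z * g + 2 * L * d z ^ 3"
      by (simp add: power2_eq_square power3_eq_cube mult_ac)
    then show ?thesis
      using dz unfolding F'_def g_def z_def[symmetric] by simp
  qed
  have intF': "integral ?Q (\<lambda>x. F' i (x, t)) = 0" if i: "i \<in> Basis" and t: "0 < t" for i t
  proof (rule integral_directional_derivative_eq_0_local[OF open_S Q K])
    show "((\<lambda>h. F i (x + h *\<^sub>R i, t)) has_real_derivative F' i (x, t)) (at 0)" if "x \<in> S" for x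
      using dF i that t by blast
    show "continuous_on S (\<lambda>x. F i (x, t))" "continuous_on S (\<lambda>x. F' i (x, t))"
      using slice cF cF' i t by auto
    \<comment> \<open>Off \<open>K\<close> the term \<open>max 0 w powr p\<close> is zero and
      \<open>d = - u < 0\<close>, so the flux vanishes before the boundary of the box is
      reached.\<close>
    fix x assume x: "x \<in> S" "x \<notin> K"
    then have "max 0 (w (x, t)) = 0" using supp t by auto
    then have "d (x, t) < 0" using u_pos x t p by (simp add: d_def)
    then show "F i (x, t) = 0" by (simp add: F_def)
  qed
  have E'_le: "E' t \<le> (6 * DIM('a) * L) * E t" if t: "0 < t" "t \<le> T" for t
  proof -
    have cont3: "continuous_on ?Q (\<lambda>x. max 0 (d (x, t)) ^ 3)"
      by (intro continuous_intros slice cd Q t)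
    have "E' t \<le> integral ?Q (\<lambda>x. 3 * ((\<Sum>i\<in>Basis. F' i (x, t)) + (DIM('a) * 2 * L) * max 0 (d (x, t)) ^ 3))"
      unfolding E'_def
    proof (rule integral_le)
      show "(\<lambda>x. 3 * max 0 (d (x, t)) ^ 2 * dt (x, t)) integrable_on ?Q"
        by (intro integrable_continuous continuous_intros slice cd cdt Q t)
      show "(\<lambda>x. 3 * ((\<Sum>i\<in>Basis. F' i (x, t)) + (DIM('a) * 2 * L) * max 0 (d (x, t)) ^ 3)) integrable_on ?Q"
        by (intro integrable_continuous continuous_intros slice cd cF' Q t)
      fix x assume x: "x \<in> ?Q"
      have "max 0 (d (x, t)) ^ 2 * dt (x, t) \<le> (\<Sum>i\<in>Basis. max 0 (d (x, t)) ^ 2 * (w2 i (x, t) - v2 i (x, t)))"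
      proof (cases "0 < d (x, t)")
        case True
        then have "0 < max 0 (w (x, t)) powr p" using u_pos[of x t] x Q t by (auto simp: d_def)
        then have w: "0 < w (x, t)" by (auto simp: max_def split: if_splits)
        then have "dt (x, t) \<le> (\<Sum>i\<in>Basis. w2 i (x, t)) - (\<Sum>i\<in>Basis. v2 i (x, t))"
          using sub[OF x t w] pde[of x t] x Q t by (auto simp: dt_def p_def)
        then have "max 0 (d (x, t)) ^ 2 * dt (x, t) \<le> max 0 (d (x, t)) ^ 2 * (\<Sum>i\<in>Basis. w2 i (x, t) - v2 i (x, t))"
          by (intro mult_left_mono) (auto simp: sum_subtractf)
        then show ?thesis by (simp add: sum_distrib_left)
      next
        case False
        then have "max 0 (d (x, t)) = 0" by simp
        then show ?thesis by simp
      qed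
      also have "\<dots> \<le> (\<Sum>i\<in>Basis. F' i (x, t) + 2 * L * max 0 (d (x, t)) ^ 3)"
        by (intro sum_mono pointwise x t)
      also have "\<dots> = (\<Sum>i\<in>Basis. F' i (x, t)) + (DIM('a) * 2 * L) * max 0 (d (x, t)) ^ 3"
        by (simp add: sum.distrib)
      finally show "3 * max 0 (d (x, t)) ^ 2 * dt (x, t)
          \<le> 3 * ((\<Sum>i\<in>Basis. F' i (x, t)) + (DIM('a) * 2 * L) * max 0 (d (x, t)) ^ 3)" by simp
    qed
    also have "\<dots> = 3 * ((\<Sum>i\<in>Basis. integral ?Q (\<lambda>x. F' i (x, t))) + (DIM('a) * 2 * L) * E t)"
    proof -
      have I1: "(\<lambda>x. F' i (x, t)) integrable_on ?Q" if "i \<in> Basis" for i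
        using that by (intro integrable_continuous slice cF' Q t)
      have I2: "(\<lambda>x. max 0 (d (x, t)) ^ 3) integrable_on ?Q"
        by (rule integrable_continuous[OF cont3])
      have "((\<lambda>x. 3 * ((\<Sum>i\<in>Basis. F' i (x, t)) + (DIM('a) * 2 * L) * max 0 (d (x, t)) ^ 3)) has_integral
          3 * ((\<Sum>i\<in>Basis. integral ?Q (\<lambda>x. F' i (x, t))) + (DIM('a) * 2 * L) * E t)) ?Q"
        unfolding E_def
        by (intro has_integral_mult_right has_integral_add has_integral_sum integrable_integral I1 I2) auto
      then show ?thesis by (rule integral_unique)
    qed
    also have "\<dots> = (6 * DIM('a) * L) * E t"
      using intF' t by simp
    finally show ?thesis .
  qed
  have "E t \<le> 0"
    by (rule gronwall_zero[where E = E and E' = E' and c = "6 * DIM('a) * L" and T = T])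
       (use dE E'_le init t in \<open>auto simp: E_def[abs_def] d_def p_def\<close>)
  moreover have "0 \<le> E t"
    unfolding E_def by (rule integral_nonneg) (use t Q in \<open>auto intro!: integrable_continuous continuous_intros slice cd\<close>)
  ultimately have "integral ?Q (\<lambda>x. max 0 (d (x, t)) ^ 3) = 0" by (simp add: E_def)
  moreover have "continuous_on ?Q (\<lambda>x. max 0 (d (x, t)) ^ 3)"
    by (intro continuous_intros slice cd Q t)
  ultimately have "max 0 (d (x, t)) ^ 3 = 0"
    using integral_cbox_eq_0_iff[of a b "\<lambda>x. max 0 (d (x, t)) ^ 3"] ne x by auto
  then have le: "max 0 (w (x, t)) powr p \<le> u (x, t)" by (auto simp: d_def max_def split: if_splits)
  show ?thesis
  proof (cases "0 < w (x, t)")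
    case True
    then have "w (x, t) = (w (x, t) powr p) powr m" using m_pos by (simp add: powr_powr p_def)
    also have "\<dots> \<le> u (x, t) powr m" using le True m_pos by (intro powr_mono2) auto
    finally show ?thesis .
  next
    case False
    then show ?thesis using powr_ge_zero[of "u (x, t)" m] by linarith
  qed
qed

end

section \<open>Outward propagation of lower bounds\<close>

context fde_solution
begin

text \<open>
  The barrier \<open>\<kappa> (\<bar>x - y\<bar>\<^bsup>-b\<^esup> - r\<^bsup>-b\<^esup> + \<eta> (t - t\<^sub>0))\<close> is nonpositive at time \<open>t\<^sub>0\<close> and stays below \<open>H\<close>
  on the inner sphere and below \<open>0\<close> on the outer sphere until it has reached its final profile.
\<close>

lemma annulus_lower_bound:
  fixes y :: 'a and r R H b :: real
  assumes rR: "0 < r" "r < R" and sub: "cball y R - ball y r \<subseteq> S" and H: "0 < H"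
    and b: "0 < b" "real DIM('a) - 2 < b" and T0: "0 < T0"
    and inner: "\<And>x t. dist y x = r \<Longrightarrow> T0 \<le> t \<Longrightarrow> H \<le> u (x, t) powr m"
  obtains T1 where "T0 \<le> T1"
    "\<And>x t. T1 \<le> t \<Longrightarrow> r \<le> dist y x \<Longrightarrow> dist y x \<le> R \<Longrightarrow>
       H * r powr b * (dist y x powr (- b) - R powr (- b)) \<le> u (x, t) powr m"
proof -
  define q where "q = 1 / m - 1"
  have q: "0 < q" using m_pos m_less by (simp add: q_def)
  define \<kappa> where "\<kappa> = H * r powr b"
  have \<kappa>: "0 < \<kappa>" using H rR by (simp add: \<kappa>_def)
  \<comment> \<open>The Laplacian of \<open>\<bar>x - y\<bar>^(-b)\<close> is smallest over the
    annulus at the outer radius, where it equals \<open>c\<close>.\<close>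
  define c where "c = b * (b + 2 - DIM('a)) * R powr (- b - 2)"
  have c: "0 < c" using b rR by (simp add: c_def)
  \<comment> \<open>At an interior minimum of \<open>u^m - w\<close> with
    \<open>u powr m \<le> H\<close>, the equation forces \<open>u^m\<close> to rise at speed at
    least \<open>m * H powr (- q) * \<kappa> * c\<close>. The barrier rises at half this speed,
    \<open>\<kappa> * \<eta>\<close>.\<close>
  define \<eta> where "\<eta> = m * c / (2 * H powr q)"
  have \<eta>: "0 < \<eta>" using c H m_pos by (simp add: \<eta>_def)
  \<comment> \<open>The time in which the rise of the barrier turns the subtracted constant
    \<open>r powr (- b)\<close> into \<open>R powr (- b)\<close>.\<close>
  define \<tau> where "\<tau> = (r powr (- b) - R powr (- b)) / \<eta>"
  have "R powr (- b) < r powr (- b)"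
    using rR b by (intro powr_less_mono2_neg) auto
  then have \<tau>: "0 < \<tau>" using \<eta> by (simp add: \<tau>_def)
  define A where "A = cball y R - ball y r"
  have AS: "A \<subseteq> S" and compA: "compact A"
    using sub by (auto simp: A_def intro: compact_diff)
  have inA: "x \<in> A \<longleftrightarrow> r \<le> dist y x \<and> dist y x \<le> R" for x by (auto simp: A_def)
  have "\<kappa> * (dist y x powr (- b) - R powr (- b)) \<le> u (x, t0 + \<tau>) powr m"
    if x: "x \<in> A" and t0: "T0 \<le> t0" for x t0
  proof (rule ccontr)
    assume less: "\<not> ?thesis"
    define N where "N x = (x - y) \<bullet> (x - y)" for x
    have Npos: "0 < N x" if "x \<in> A" for x
      using that rR by (auto simp: N_def inA)
    have N_powr: "N x powr (- (b / 2)) = dist y x powr (- b)" for x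
    proof -
      have "N x = dist y x powr 2"
        by (simp add: N_def dist_norm norm_minus_commute power2_norm_eq_inner[symmetric])
      then show ?thesis by (simp only: powr_powr) simp
    qed
    define w where "w z = \<kappa> * (N (fst z) powr (- (b / 2)) - r powr (- b) + \<eta> * (snd z - t0))" for z
    define G where "G z = u z powr m - w z" for z
    let ?C = "A \<times> {t0..t0 + \<tau>}"
    have sub_C: "?C \<subseteq> S \<times> {0<..}" using AS t0 T0 by auto
    have contG: "continuous_on ?C G"
      unfolding G_def w_def N_def using u_pos sub_C Npos
      by (intro continuous_intros continuous_on_subset[OF cont_u]) (force simp: N_def)+
    have "compact ?C" using compA by (intro compact_Times) auto
    moreover have "(x, t0 + \<tau>) \<in> ?C" using x \<tau> by auto
    ultimately obtain z where z: "z \<in> ?C" and zmin: "\<And>z'. z' \<in> ?C \<Longrightarrow> G z \<le> G z'"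
      using continuous_attains_inf[OF _ _ contG] by blast
    obtain x1 t1 where zeq: "z = (x1, t1)" by (cases z)
    have x1: "x1 \<in> A" and t1: "t0 \<le> t1" "t1 \<le> t0 + \<tau>" using z zeq by auto
    have x1S: "x1 \<in> S" and t1pos: "0 < t1" using x1 AS t1 t0 T0 by auto
    have "G (x, t0 + \<tau>) < 0"
      using less \<eta> by (simp add: G_def w_def N_powr \<tau>_def)
    \<comment> \<open>A negative minimum cannot lie on the parabolic boundary:
      \<open>w \<le> 0\<close> initially and on the outer sphere, and
      \<open>w \<le> H \<le> u powr m\<close> on the inner one.\<close>
    then have neg: "G (x1, t1) < 0" using zmin[of "(x, t0 + \<tau>)"] \<open>(x, t0 + \<tau>) \<in> ?C\<close> zeq by auto
    have u1: "0 < u (x1, t1)" using u_pos x1S t1pos by blast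
    have wpos: "0 < w (x1, t1)"
      using neg powr_ge_zero[of "u (x1, t1)" m] unfolding G_def by linarith
    have time: "\<eta> * (t1 - t0) \<le> r powr (- b) - R powr (- b)"
      using t1 \<eta> mult_left_mono[of "t1 - t0" \<tau> \<eta>] by (simp add: \<tau>_def)
    have mono: "dist y x1 powr (- b) \<le> r powr (- b)"
      using x1 rR b by (intro powr_mono2') (auto simp: inA)
    have w_le: "w (x1, t1) \<le> H"
    proof -
      have "w (x1, t1) \<le> \<kappa> * (r powr (- b) - R powr (- b))"
        unfolding w_def using \<kappa> time mono by (intro mult_left_mono) (auto simp: N_powr)
      also have "\<dots> \<le> \<kappa> * r powr (- b)" using \<kappa> by (intro mult_left_mono) auto
      also have "\<dots> = H" using rR by (simp add: \<kappa>_def powr_minus)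
      finally show ?thesis .
    qed
    have "t1 \<noteq> t0"
    proof
      assume "t1 = t0"
      then have "w (x1, t1) \<le> 0"
        using \<kappa> mono by (auto simp: w_def N_powr mult_le_0_iff)
      then show False using wpos by simp
    qed
    then have t1_gt: "t0 < t1" using t1 by simp
    have "dist y x1 \<noteq> r"
    proof
      assume "dist y x1 = r"
      then have "H \<le> u (x1, t1) powr m" using inner t1 t0 by auto
      then show False using neg w_le by (simp add: G_def)
    qed
    moreover have "dist y x1 \<noteq> R"
    proof
      assume "dist y x1 = R"
      then have "w (x1, t1) \<le> 0" using \<kappa> time by (auto simp: w_def N_powr mult_le_0_iff)
      then show False using wpos by simp
    qed
    ultimately have "r < dist y x1" "dist y x1 < R" using x1 by (auto simp: inA)
    then have "x1 \<in> ball y R - cball y r" by auto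
    then obtain e where e: "0 < e" "ball x1 e \<subseteq> ball y R - cball y r"
      by (meson open_contains_ball open_Diff open_ball closed_cball)
    have ballA: "x1 + h *\<^sub>R i \<in> A" if "\<bar>h\<bar> < e" "i \<in> Basis" for h i
    proof -
      have "x1 + h *\<^sub>R i \<in> ball x1 e" using that by (simp add: dist_norm)
      then show ?thesis using e(2) by (auto simp: A_def)
    qed
    define w1 where "w1 i x = 2 * (- (b / 2)) * N x powr (- (b / 2) - 1) * ((x - y) \<bullet> i)" for i x
    define w2 where "w2 i x = 4 * (- (b / 2)) * (- (b / 2) - 1) * N x powr (- (b / 2) - 2) * ((x - y) \<bullet> i)\<^sup>2
      + 2 * (- (b / 2)) * N x powr (- (b / 2) - 1) * (i \<bullet> i)" for i x
    have second: "0 \<le> v2 i (x1, t1) - \<kappa> * w2 i x1" if i: "i \<in> Basis" for i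
    proof (rule second_derivative_nonneg_at_min[OF e(1)])
      let ?f = "\<lambda>h. G (x1 + h *\<^sub>R i, t1)"
      let ?f' = "\<lambda>h. v1 i (x1 + h *\<^sub>R i, t1) - \<kappa> * w1 i (x1 + h *\<^sub>R i)"
      show "(?f has_real_derivative ?f' h) (at h)" if h: "\<bar>h\<bar> < e" for h
      proof (rule has_real_derivative_line_shift[where f = "\<lambda>x. G (x, t1)"])
        have xh: "x1 + h *\<^sub>R i \<in> A" by (rule ballA[OF h i])
        have dN: "((\<lambda>k. N (x1 + h *\<^sub>R i + k *\<^sub>R i) powr (- (b / 2))) has_real_derivative w1 i (x1 + h *\<^sub>R i)) (at 0)"
          using has_real_derivative_radial_powr[of "x1 + h *\<^sub>R i" y 0 i "- (b / 2)"] Npos[OF xh]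
          by (simp add: N_def w1_def)
        have "((\<lambda>k. w (x1 + h *\<^sub>R i + k *\<^sub>R i, t1)) has_real_derivative \<kappa> * w1 i (x1 + h *\<^sub>R i)) (at 0)"
          unfolding w_def fst_conv snd_conv
          by (rule DERIV_cong[OF DERIV_cmult[OF DERIV_add[OF DERIV_diff[OF dN DERIV_const] DERIV_const]]]) simp
        then show "((\<lambda>k. G (x1 + h *\<^sub>R i + k *\<^sub>R i, t1)) has_real_derivative ?f' h) (at 0)"
          unfolding G_def using xh AS by (intro derivative_intros deriv_x i t1pos) auto
      qed
      have "((\<lambda>h. w1 i (x1 + h *\<^sub>R i)) has_real_derivative w2 i x1) (at 0)"
        using has_real_derivative_radial_powr2[of x1 y 0 "- (b / 2)" i] Npos[OF x1]
        by (simp add: N_def w1_def w2_def)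
      then show "(?f' has_real_derivative v2 i (x1, t1) - \<kappa> * w2 i x1) (at 0)"
        using deriv_xx[OF i x1S t1pos] by (intro DERIV_diff DERIV_cmult)
      show "?f 0 \<le> ?f h" if "\<bar>h\<bar> < e" for h
        using zmin[of "(x1 + h *\<^sub>R i, t1)"] ballA[OF that i] t1 zeq by simp
    qed
    have "\<kappa> * (\<Sum>i\<in>Basis. w2 i x1) \<le> (\<Sum>i\<in>Basis. v2 i (x1, t1))"
      using sum_mono[of Basis "\<lambda>i. \<kappa> * w2 i x1" "\<lambda>i. v2 i (x1, t1)"] second
      by (simp add: sum_distrib_left)
    moreover have "c \<le> (\<Sum>i\<in>Basis. w2 i x1)"
    proof -
      have "(\<Sum>i\<in>Basis. w2 i x1) = b * (b + 2 - DIM('a)) * (N x1 powr (- (b / 2) - 2) * N x1)"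
        using laplacian_radial_powr[of x1 y 0 "- (b / 2)"] Npos[OF x1]
        by (simp add: N_def w2_def algebra_simps)
      also have "N x1 powr (- (b / 2) - 2) * N x1 = N x1 powr (- (b / 2) - 1)"
        by (rule powr_diff_two_mult[OF Npos[OF x1]])
      also have "\<dots> = dist y x1 powr (- b - 2)"
      proof -
        have "N x1 = dist y x1 powr 2"
          by (simp add: N_def dist_norm norm_minus_commute power2_norm_eq_inner[symmetric])
        then show ?thesis by (simp only: powr_powr) (simp add: algebra_simps)
      qed
      finally have eq: "(\<Sum>i\<in>Basis. w2 i x1) = b * (b + 2 - DIM('a)) * dist y x1 powr (- b - 2)" .
      have "R powr (- b - 2) \<le> dist y x1 powr (- b - 2)"
        using x1 rR b by (intro powr_mono2') (auto simp: inA)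
      then show ?thesis
        unfolding eq c_def using b by (intro mult_left_mono) auto
    qed
    ultimately have ut_ge: "\<kappa> * c \<le> ut (x1, t1)"
      using pde[OF x1S t1pos] mult_left_mono[of c "\<Sum>i\<in>Basis. w2 i x1" \<kappa>] \<kappa> by linarith
    have "m * u (x1, t1) powr (m - 1) * ut (x1, t1) - \<kappa> * \<eta> \<le> 0"
    proof (rule derivative_nonpos_at_left_min[OF _ t1_gt])
      have "((\<lambda>s. u (x1, s) powr m) has_real_derivative m * u (x1, t1) powr (m - 1) * ut (x1, t1)) (at t1)"
        using DERIV_chain2[OF has_real_derivative_powr[OF u1] deriv_t[OF x1S t1pos]] .
      moreover have "((\<lambda>s. w (x1, s)) has_real_derivative \<kappa> * \<eta>) (at t1)"
        unfolding w_def by (auto intro!: derivative_eq_intros)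
      ultimately show "((\<lambda>s. G (x1, s)) has_real_derivative m * u (x1, t1) powr (m - 1) * ut (x1, t1) - \<kappa> * \<eta>) (at t1)"
        unfolding G_def by (rule DERIV_diff)
      show "G (x1, t1) \<le> G (x1, s)" if "t0 \<le> s" "s \<le> t1" for s
        using zmin[of "(x1, s)"] that t1 x1 zeq by simp
    qed
    moreover have "m * u (x1, t1) powr (m - 1) * (\<kappa> * c) \<le> m * u (x1, t1) powr (m - 1) * ut (x1, t1)"
      using ut_ge m_pos by (intro mult_left_mono) auto
    ultimately have "\<kappa> * (m * u (x1, t1) powr (m - 1) * c) \<le> \<kappa> * \<eta>" by (simp add: mult_ac)
    then have 1: "m * u (x1, t1) powr (m - 1) * c \<le> \<eta>" using \<kappa> by simp
    have "u (x1, t1) powr m \<le> H" using neg w_le by (simp add: G_def)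
    then have "(u (x1, t1) powr m) powr q \<le> H powr q" using q by (intro powr_mono2) auto
    moreover have "(u (x1, t1) powr m) powr q = u (x1, t1) powr (1 - m)"
      using m_pos by (simp add: powr_powr q_def right_diff_distrib)
    ultimately have "u (x1, t1) powr (1 - m) \<le> H powr q" by simp
    moreover have "u (x1, t1) powr (m - 1) * u (x1, t1) powr (1 - m) = 1"
      using u1 by (simp add: powr_add[symmetric])
    ultimately have "1 \<le> u (x1, t1) powr (m - 1) * H powr q"
      using mult_left_mono[of "u (x1, t1) powr (1 - m)" "H powr q" "u (x1, t1) powr (m - 1)"] by simp
    then have "m * c * 1 \<le> m * c * (u (x1, t1) powr (m - 1) * H powr q)"
      using m_pos c by (intro mult_left_mono) auto
    also have "\<dots> = (m * u (x1, t1) powr (m - 1) * c) * H powr q" by (simp add: mult_ac)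
    also have "\<dots> \<le> \<eta> * H powr q" using 1 by (intro mult_right_mono) auto
    also have "\<dots> = m * c / 2" using H by (simp add: \<eta>_def)
    finally show False using m_pos c by (simp add: zero_less_mult_iff)
  qed
  \<comment> \<open>Every \<open>t \<ge> T0 + \<tau>\<close> is the final time of a barrier started
    at \<open>t0 = t - \<tau>\<close>, so the bound persists.\<close>
  then have "\<kappa> * (dist y x powr (- b) - R powr (- b)) \<le> u (x, t) powr m"
    if "T0 + \<tau> \<le> t" "x \<in> A" for x t
    using that(1) that(2) by (metis add_diff_cancel_right' diff_add_cancel le_diff_eq)
  then show ?thesis
    using that[of "T0 + \<tau>"] \<tau> by (auto simp: inA \<kappa>_def)
qed

end

section \<open>Persistence of the singularity\<close>

text \<open>
  Where the Laplacian of \<open>(X + s)\<^bsup>-\<beta>/2\<^esup>\<close>, with \<open>X = \<bar>x - y\<bar>\<^sup>2\<close>, is negative, \<open>X + s\<close> is of order \<open>s\<close>, hence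
  \<open>w\<close> is of order \<open>(X + s)\<^bsup>-\<beta>/2\<^esup>\<close>. As \<open>\<beta> (1 - m) / m > 2\<close>, the growth \<open>s' = c s\<close> compensates.
\<close>

lemma concentrated_barrier_subsolution:
  fixes m \<beta> k B n :: real
  assumes m: "0 < m" "m < 1" and n: "1 \<le> n" and \<beta>: "0 < \<beta>" "n - 2 < \<beta>" "2 < \<beta> * (1 / m - 1)"
    and k: "0 < k" and B: "0 < B"
  obtains c \<sigma> where "0 < c" "0 < \<sigma>"
    "\<And>X s w. 0 \<le> X \<Longrightarrow> 0 < s \<Longrightarrow> s \<le> \<sigma> \<Longrightarrow> w = k * ((X + s) powr (- (\<beta> / 2)) - B) \<Longrightarrow> 0 < w \<Longrightarrow>
      (1 / m) * w powr (1 / m - 1) * (k * (- (\<beta> / 2) * (X + s) powr (- (\<beta> / 2) - 1) * (c * s)))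
      \<le> k * (2 * (- (\<beta> / 2)) * (X + s) powr (- (\<beta> / 2) - 2) * ((2 * (- (\<beta> / 2)) - 2 + n) * X + n * s))"
proof -
  define q where "q = 1 / m - 1"
  define e where "e = \<beta> / 2"
  \<comment> \<open>Where \<open>n * s\<close> exceeds \<open>(\<beta> + 2 - n) * X\<close>, one has
    \<open>X + s \<le> \<Lambda> * s\<close>. With \<open>s \<le> \<sigma>\<close> this gives
    \<open>X + s \<le> Z\<close>, hence \<open>(X + s) powr (- e) \<ge> 2 * B\<close> and
    \<open>w \<ge> (k / 2) * (X + s) powr (- e)\<close>; \<open>c\<close> is the growth rate that
    \<open>main\<close> then requires.\<close>
  define \<Lambda> where "\<Lambda> = 1 + n / (\<beta> + 2 - n)"
  have \<Lambda>: "1 \<le> \<Lambda>" using \<beta> n by (simp add: \<Lambda>_def)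
  define Z where "Z = (2 * B) powr (- (1 / e))"
  define \<sigma> where "\<sigma> = Z / \<Lambda>"
  define c where "c = 2 * m * n / ((k / 2) powr q * Z powr (1 - e * q))"
  have e: "0 < e" using \<beta> by (simp add: e_def)
  have q: "0 < q" using m by (simp add: q_def)
  have eq: "1 < e * q" using \<beta> by (simp add: e_def q_def)
  have Z: "0 < Z" using B by (simp add: Z_def)
  have \<sigma>: "0 < \<sigma>" using Z \<Lambda> by (simp add: \<sigma>_def)
  have c: "0 < c" using m n k Z by (simp add: c_def)
  have Ze: "Z powr (- e) = 2 * B" using B e by (simp add: Z_def powr_powr)
  show ?thesis
  proof (rule that[OF c \<sigma>])
    fix X s w :: real
    assume X: "0 \<le> X" and s: "0 < s" "s \<le> \<sigma>" and w: "w = k * ((X + s) powr (- (\<beta> / 2)) - B)" "0 < w"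
    define N where "N = X + s"
    have N: "0 < N" using X s by (simp add: N_def)
    have Npow: "N powr (- e - 1) = N powr (- e - 2) * N"
      using powr_diff_two_mult[OF N] by metis
    \<comment> \<open>The claim divided by the common factor
      \<open>k * \<beta> * N powr (- e - 2)\<close>, with the signs of both sides reversed.\<close>
    have main: "n * s - (\<beta> + 2 - n) * X \<le> (1 / (2 * m)) * w powr q * N * c * s"
    proof (cases "n * s \<le> (\<beta> + 2 - n) * X")
      case True
      moreover have "0 \<le> (1 / (2 * m)) * w powr q * N * c * s"
        using m N c s by (intro mult_nonneg_nonneg) auto
      ultimately show ?thesis by linarith
    next
      case False
      then have "X \<le> (n / (\<beta> + 2 - n)) * s" using \<beta> by (simp add: field_simps)
      then have "N \<le> \<Lambda> * s" by (simp add: N_def \<Lambda>_def algebra_simps)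
      also have "\<dots> \<le> \<Lambda> * \<sigma>" using s \<Lambda> by (intro mult_left_mono) auto
      finally have NZ: "N \<le> Z" using \<Lambda> by (simp add: \<sigma>_def)
      have "2 * B \<le> N powr (- e)"
        unfolding Ze[symmetric] using N NZ e by (intro powr_mono2') auto
      then have "k * (2 * B) \<le> k * N powr (- e)" using k by (intro mult_left_mono) auto
      moreover have "w = k * N powr (- e) - k * B"
        unfolding w(1) N_def e_def by (simp add: right_diff_distrib)
      ultimately have "(k / 2) * N powr (- e) \<le> w" by linarith
      then have "((k / 2) * N powr (- e)) powr q \<le> w powr q"
        using q k by (intro powr_mono2) auto
      moreover have "((k / 2) * N powr (- e)) powr q = (k / 2) powr q * N powr (- (e * q))"
        by (simp only: powr_mult powr_powr mult_minus_left)
      ultimately have wq: "(k / 2) powr q * N powr (- (e * q)) \<le> w powr q" by simp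
      \<comment> \<open>The exponent \<open>1 - e * q\<close> is negative, so replacing
        \<open>Z\<close> by \<open>N \<le> Z\<close> does not decrease the power; here
        \<open>2 < \<beta> * (1 / m - 1)\<close> enters.\<close>
      have "(k / 2) powr q * Z powr (1 - e * q) \<le> (k / 2) powr q * N powr (1 - e * q)"
        using N NZ eq by (intro mult_left_mono powr_mono2') auto
      also have "\<dots> = (k / 2) powr q * N powr (- (e * q)) * N"
        using powr_add[of N "- (e * q)" 1] N by simp
      also have "\<dots> \<le> w powr q * N" using wq N by (intro mult_right_mono) auto
      finally have "c * ((k / 2) powr q * Z powr (1 - e * q)) \<le> c * (w powr q * N)"
        using c by (intro mult_left_mono) auto
      then have "2 * m * n \<le> c * (w powr q * N)"
        using k Z by (simp add: c_def)
      then have "n \<le> (1 / (2 * m)) * w powr q * N * c"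
        using m by (simp add: field_simps)
      then have "n * s \<le> (1 / (2 * m)) * w powr q * N * c * s"
        using s by (intro mult_right_mono) auto
      moreover have "0 \<le> (\<beta> + 2 - n) * X" using \<beta> X by simp
      ultimately show ?thesis by linarith
    qed
    have "0 \<le> k * \<beta> * N powr (- e - 2)" using k \<beta> by simp
    from mult_left_mono[OF main this]
    have "- (k * \<beta> * N powr (- e - 2) * ((1 / (2 * m)) * w powr q * N * c * s))
        \<le> - (k * \<beta> * N powr (- e - 2) * (n * s - (\<beta> + 2 - n) * X))" by linarith
    moreover have "- (k * \<beta> * N powr (- e - 2) * ((1 / (2 * m)) * w powr q * N * c * s))
        = (1 / m) * w powr q * (k * (- e * N powr (- e - 1) * (c * s)))"
      unfolding Npow by (simp add: e_def mult_ac)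
    moreover have "- (k * \<beta> * N powr (- e - 2) * (n * s - (\<beta> + 2 - n) * X))
        = k * (2 * - e * N powr (- e - 2) * ((2 * - e - 2 + n) * X + n * s))"
      by (simp add: e_def algebra_simps)
    ultimately show "(1 / m) * w powr (1 / m - 1) * (k * (- (\<beta> / 2) * (X + s) powr (- (\<beta> / 2) - 1) * (c * s)))
      \<le> k * (2 * (- (\<beta> / 2)) * (X + s) powr (- (\<beta> / 2) - 2) * ((2 * (- (\<beta> / 2)) - 2 + n) * X + n * s))"
      by (simp only: N_def[symmetric] e_def[symmetric] q_def[symmetric])
  qed
qed

text \<open>This is \<open>subsolution_le\<close> for the barrier with shift
  \<open>s0 * exp (c * t)\<close>. Attaining the initial value in the integral sense suffices,
  because for a bounded barrier the cube in the energy is at most a constant times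
  \<open>\<bar>u - g\<bar>\<close>. Integrability is a separate assumption, as a Bochner integral
  defaults to 0.\<close>

lemma (in fde_solution) concentrated_barrier_le:
  fixes y :: 'a and c \<sigma> \<beta> k \<rho> s0 T \<epsilon> :: real and g :: "'a \<Rightarrow> real"
  assumes \<beta>: "0 < \<beta>" and k: "0 < k" and \<rho>: "0 < \<rho>" and c: "0 < c"
    and Q: "cbox a b \<subseteq> S" "cball y \<rho> \<subseteq> box a b"
    and \<epsilon>: "0 < \<epsilon>" and u_ge: "\<And>x t. x \<in> S \<Longrightarrow> 0 < t \<Longrightarrow> \<epsilon> \<le> u (x, t)"
    and sub: "\<And>(X::real) (s::real) (w::real). 0 \<le> X \<Longrightarrow> 0 < s \<Longrightarrow> s \<le> \<sigma> \<Longrightarrow>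
      w = k * ((X + s) powr (- (\<beta> / 2)) - \<rho> powr (- \<beta>)) \<Longrightarrow> 0 < w \<Longrightarrow>
      (1 / m) * w powr (1 / m - 1) * (k * (- (\<beta> / 2) * (X + s) powr (- (\<beta> / 2) - 1) * (c * s)))
      \<le> k * (2 * (- (\<beta> / 2)) * (X + s) powr (- (\<beta> / 2) - 2) *
          ((2 * (- (\<beta> / 2)) - 2 + DIM('a)) * X + DIM('a) * s))"
    and s0: "0 < s0" "s0 * exp (c * T) \<le> \<sigma>"
    and int: "\<And>t. 0 < t \<Longrightarrow> set_integrable lebesgue (cbox a b) (\<lambda>x. \<bar>u (x, t) - g x\<bar>)"
    and lim: "((\<lambda>t. LINT x:cbox a b|lebesgue. \<bar>u (x, t) - g x\<bar>) \<longlongrightarrow> 0) (at_right 0)"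
    and g: "AE x in lebesgue. x \<in> cbox a b \<longrightarrow>
      (k * ((x - y) \<bullet> (x - y) + s0) powr (- (\<beta> / 2))) powr (1 / m) \<le> g x"
    and x: "x \<in> cbox a b" and T: "0 < T"
  shows "k * (((x - y) \<bullet> (x - y) + s0 * exp (c * T)) powr (- (\<beta> / 2)) - \<rho> powr (- \<beta>)) \<le> u (x, T) powr m"
proof -
  define e where "e = - (\<beta> / 2)"
  have e: "e < 0" using \<beta> by (simp add: e_def)
  define N where "N z = (fst z - y) \<bullet> (fst z - y) + s0 * exp (c * snd z)" for z
  have N: "0 < N z" for z
    using s0 by (simp add: N_def add_nonneg_pos)
  have N_ge: "(fst z - y) \<bullet> (fst z - y) + s0 \<le> N z" if "0 < snd z" for z
    using that s0 c by (simp add: N_def)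
  then have N_ge_s0: "s0 \<le> N z" if "0 < snd z" for z
    using that inner_ge_zero[of "fst z - y"] by (meson add_increasing order_trans order_refl)
  define w where "w z = k * (N z powr e - \<rho> powr (- \<beta>))" for z
  define wt where "wt z = k * (e * N z powr (e - 1) * (c * (s0 * exp (c * snd z))))" for z
  define w1 where "w1 i z = k * (2 * e * N z powr (e - 1) * ((fst z - y) \<bullet> i))" for i z
  define w2 where "w2 i z = k * (4 * e * (e - 1) * N z powr (e - 2) * ((fst z - y) \<bullet> i)\<^sup>2
      + 2 * e * N z powr (e - 1) * (i \<bullet> i))" for i z
  let ?D = "S \<times> {0<..}"
  have nz: "\<forall>z\<in>?D. N z \<noteq> 0" using N by (metis less_irrefl)
  have cN: "continuous_on ?D N" unfolding N_def by (intro continuous_intros)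
  have dN: "((\<lambda>s. N (x, s)) has_real_derivative c * (s0 * exp (c * t))) (at t)" for x t
    unfolding N_def fst_conv snd_conv by (auto intro!: derivative_eq_intros)
  obtain D where D: "0 < D" "\<And>x. x \<in> cbox a b \<Longrightarrow> norm (x - y) \<le> D"
  proof -
    have "bounded ((\<lambda>x. x - y) ` cbox a b)"
      by (intro bounded_translation_minus bounded_cbox)
    then show ?thesis using that by (auto simp: bounded_pos)
  qed
  \<comment> \<open>A bound for the power \<open>1 / m\<close> of the barrier at all positive times,
    from \<open>N \<ge> s0\<close>.\<close>
  define U0 where "U0 = (k * s0 powr e) powr (1 / m)"
  have "w (x, T) \<le> u (x, T) powr m"
  proof (rule subsolution_le[where K = "cball y \<rho>" and a = a and b = b and \<epsilon> = \<epsilon> and wt = wt and ?w1.0 = w1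
        and ?w2.0 = w2 and T = T and B = "k * (2 * \<bar>e\<bar> * s0 powr (e - 1) * D)"])
    show "box a b \<noteq> {}" using Q \<rho> by force
    show "continuous_on ?D w" "continuous_on ?D wt"
      unfolding w_def wt_def by (intro continuous_intros cN nz)+
    show "continuous_on ?D (w1 i)" "continuous_on ?D (w2 i)" for i
      unfolding w1_def w2_def by (intro continuous_intros cN nz)+
    fix x t assume xt: "x \<in> S" "0 < (t::real)"
    have dNt: "((\<lambda>s. N (x, s) powr e) has_real_derivative e * N (x, t) powr (e - 1) * (c * (s0 * exp (c * t)))) (at t)"
      by (rule DERIV_chain2[OF has_real_derivative_powr[OF N] dN])
    show "((\<lambda>s. w (x, s)) has_real_derivative wt (x, t)) (at t)"
      unfolding w_def wt_def fst_conv snd_conv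
      by (rule DERIV_cong[OF DERIV_cmult[OF DERIV_diff[OF dNt DERIV_const]]]) simp
    show "((\<lambda>h. w (x + h *\<^sub>R i, t)) has_real_derivative w1 i (x, t)) (at 0)" for i
      unfolding w_def w1_def N_def fst_conv snd_conv
      by (rule DERIV_cong[OF DERIV_cmult[OF DERIV_diff[OF has_real_derivative_radial_powr DERIV_const]]])
         (use N[of "(x, t)"] in \<open>simp_all add: N_def\<close>)
    show "((\<lambda>h. w1 i (x + h *\<^sub>R i, t)) has_real_derivative w2 i (x, t)) (at 0)" for i
      using has_real_derivative_radial_powr2[of x y "s0 * exp (c * t)" e i] N[of "(x, t)"]
      unfolding w1_def w2_def N_def fst_conv snd_conv by (intro DERIV_cmult) auto
    show "w (x, t) \<le> 0" if "x \<notin> cball y \<rho>"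
    proof -
      have "\<rho>\<^sup>2 \<le> (norm (x - y))\<^sup>2"
        using that \<rho> by (intro power_mono) (auto simp: dist_norm norm_minus_commute)
      also have "\<dots> \<le> N (x, t)"
        using s0 by (simp add: N_def power2_norm_eq_inner)
      finally have "N (x, t) powr e \<le> (\<rho>\<^sup>2) powr e"
        using \<rho> e by (intro powr_mono2') auto
      also have "(\<rho>\<^sup>2) powr e = \<rho> powr (- \<beta>)"
        using \<rho> by (simp add: powr_powr e_def flip: powr_numeral)
      finally show ?thesis using k by (simp add: w_def mult_le_0_iff)
    qed
  next
    fix i x t assume "(i::'a) \<in> Basis" "x \<in> cbox a b" and t: "0 < t" "t \<le> T"
    have "N (x, t) powr (e - 1) \<le> s0 powr (e - 1)"
      using s0 e N_ge_s0[of "(x, t)"] t by (intro powr_mono2') auto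
    moreover have "\<bar>(x - y) \<bullet> i\<bar> \<le> D"
      using Basis_le_norm[OF \<open>i \<in> Basis\<close>, of "x - y"] D(2)[OF \<open>x \<in> cbox a b\<close>] by linarith
    ultimately show "\<bar>w1 i (x, t)\<bar> \<le> k * (2 * \<bar>e\<bar> * s0 powr (e - 1) * D)"
      unfolding w1_def using k by (simp add: abs_mult) (intro mult_mono; simp)
  next
    fix x t assume "x \<in> cbox a b" and t: "0 < t" "t \<le> T" and w: "0 < w (x, t)"
    have "s0 * exp (c * t) \<le> s0 * exp (c * T)" using s0 c t by (intro mult_left_mono) auto
    then have "s0 * exp (c * t) \<le> \<sigma>" using s0 by linarith
    then have "(1 / m) * w (x, t) powr (1 / m - 1) * wt (x, t) \<le>
       k * (2 * e * N (x, t) powr (e - 2) * ((2 * e - 2 + DIM('a)) * ((x - y) \<bullet> (x - y)) + DIM('a) * (s0 * exp (c * t))))"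
      using sub[of "(x - y) \<bullet> (x - y)" "s0 * exp (c * t)" "w (x, t)"] s0 w
      by (simp add: w_def wt_def N_def e_def)
    also have "\<dots> = (\<Sum>i\<in>Basis. w2 i (x, t))"
      unfolding w2_def N_def fst_conv snd_conv sum_distrib_left[symmetric]
      by (subst laplacian_radial_powr) (use N[of "(x, t)"] in \<open>simp_all add: N_def\<close>)
    finally show "(1 / m) * w (x, t) powr (1 / m - 1) * wt (x, t) \<le> (\<Sum>i\<in>Basis. w2 i (x, t))" .
  next
    let ?f = "\<lambda>t x. max 0 (max 0 (w (x, t)) powr (1 / m) - u (x, t)) ^ 3"
    have le_U: "max 0 (w (x, t)) powr (1 / m) \<le> (k * ((x - y) \<bullet> (x - y) + s0) powr e) powr (1 / m)"
      "max 0 (w (x, t)) powr (1 / m) \<le> U0" if "0 < t" for x t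
    proof -
      have pos: "0 < (x - y) \<bullet> (x - y) + s0" using s0 by (simp add: add_nonneg_pos)
      have "N (x, t) powr e \<le> ((x - y) \<bullet> (x - y) + s0) powr e"
        using N_ge[of "(x, t)"] that pos e by (intro powr_mono2') auto
      then have "N (x, t) powr e - \<rho> powr (- \<beta>) \<le> ((x - y) \<bullet> (x - y) + s0) powr e"
        using powr_ge_zero[of \<rho> "- \<beta>"] by linarith
      then have "w (x, t) \<le> k * ((x - y) \<bullet> (x - y) + s0) powr e"
        unfolding w_def using k by (intro mult_left_mono) auto
      then show "max 0 (w (x, t)) powr (1 / m) \<le> (k * ((x - y) \<bullet> (x - y) + s0) powr e) powr (1 / m)"
        using m_pos k by (intro powr_mono2) auto
      also have "\<dots> \<le> U0"
        unfolding U0_def using m_pos k s0 e by (intro powr_mono2 mult_left_mono powr_mono2') auto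
      finally show "max 0 (w (x, t)) powr (1 / m) \<le> U0" .
    qed
    have cf: "continuous_on (cbox a b) (?f t)" if "0 < t" for t
      unfolding w_def using m_pos Q that N
      by (intro continuous_intros continuous_on_powr' continuous_on_compose2[OF cont_u] continuous_on_compose2[OF cN])
         (auto simp: less_imp_neq[symmetric])
    have if_f: "set_integrable lebesgue (cbox a b) (?f t)" if "0 < t" for t
      using absolutely_integrable_continuous[OF cf[OF that]] .
    have eq: "integral (cbox a b) (?f t) = (LINT x:cbox a b|lebesgue. ?f t x)" if "0 < t" for t
      using set_lebesgue_integral_eq_integral(2)[OF if_f[OF that]] by simp
    have le: "integral (cbox a b) (?f t) \<le> U0\<^sup>2 * (LINT x:cbox a b|lebesgue. \<bar>u (x, t) - g x\<bar>)" if t: "0 < t" for t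
    proof -
      have "(LINT x:cbox a b|lebesgue. ?f t x) \<le> (LINT x:cbox a b|lebesgue. U0\<^sup>2 * \<bar>u (x, t) - g x\<bar>)"
        unfolding set_lebesgue_integral_def
      proof (rule integral_mono_AE)
        show "integrable lebesgue (\<lambda>x. indicat_real (cbox a b) x *\<^sub>R ?f t x)"
          using if_f[OF t] by (simp add: set_integrable_def)
        show "integrable lebesgue (\<lambda>x. indicat_real (cbox a b) x *\<^sub>R (U0\<^sup>2 * \<bar>u (x, t) - g x\<bar>))"
          using set_integrable_mult_right[OF int[OF t], of "U0\<^sup>2"] by (simp add: set_integrable_def)
        show "AE x in lebesgue. indicat_real (cbox a b) x *\<^sub>R ?f t x \<le> indicat_real (cbox a b) x *\<^sub>R (U0\<^sup>2 * \<bar>u (x, t) - g x\<bar>)"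
          using g
        proof eventually_elim
          case (elim x)
          show ?case
          proof (cases "x \<in> cbox a b")
            case True
            define d where "d = max 0 (max 0 (w (x, t)) powr (1 / m) - u (x, t))"
            have "0 < u (x, t)" using u_pos Q True t by blast
            \<comment> \<open>By \<open>g\<close> the power of the barrier is at most
              \<open>g x\<close>, so a positive \<open>d\<close> is at most
              \<open>g x - u (x, t)\<close>.\<close>
            then have d: "0 \<le> d" "d \<le> U0" "d \<le> \<bar>u (x, t) - g x\<bar>"
              using elim True le_U[OF t, of x] powr_ge_zero[of "k * s0 powr e" "1 / m"]
              by (auto simp: d_def e_def U0_def)
            have "d ^ 3 = d\<^sup>2 * d" by (simp add: power2_eq_square power3_eq_cube)
            also have "\<dots> \<le> U0\<^sup>2 * \<bar>u (x, t) - g x\<bar>"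
              using d by (intro mult_mono power_mono) auto
            finally show ?thesis using True by (simp add: d_def)
          qed simp
        qed
      qed
      then show ?thesis unfolding eq[OF t] by simp
    qed
    show "((\<lambda>t. integral (cbox a b) (?f t)) \<longlongrightarrow> 0) (at_right 0)"
    proof (rule tendsto_sandwich)
      show "\<forall>\<^sub>F t in at_right 0. 0 \<le> integral (cbox a b) (?f t)"
        unfolding eventually_at_right_field
        by (intro exI[of _ 1]) (auto intro!: integral_nonneg integrable_continuous cf)
      show "\<forall>\<^sub>F t in at_right 0. integral (cbox a b) (?f t) \<le> U0\<^sup>2 * (LINT x:cbox a b|lebesgue. \<bar>u (x, t) - g x\<bar>)"
        unfolding eventually_at_right_field
        by (intro exI[of _ 1]) (auto intro!: le)
      show "((\<lambda>t. U0\<^sup>2 * (LINT x:cbox a b|lebesgue. \<bar>u (x, t) - g x\<bar>)) \<longlongrightarrow> 0) (at_right 0)"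
        using tendsto_mult_left[OF lim, of "U0\<^sup>2"] by simp
    qed simp
  qed (use Q \<epsilon> u_ge x T in auto)
  then show ?thesis by (simp add: w_def N_def e_def)
qed

text \<open>Truncation bounds the integrand on \<open>Q\<close>; the work lies in measurability,
  since \<open>u0\<close> is controlled only on compact sets that avoid \<open>y\<close>.\<close>

lemma set_integrable_initial_difference:
  fixes u0 h :: "'a::euclidean_space \<Rightarrow> real"
  assumes u0: "Lp_loc p X u0" and Q: "compact Q" "Q - {y} \<subseteq> X" and h: "continuous_on Q h"
    and u0_ge: "AE x in lebesgue. x \<in> Q - {y} \<longrightarrow> 0 \<le> u0 x" and M: "0 < M"
  shows "set_integrable lebesgue Q (\<lambda>x. \<bar>h x - (min (u0 x) M + \<epsilon>)\<bar>)"
proof -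
  have Qs: "Q \<in> sets lebesgue" using Q by (intro lmeasurable_compact fmeasurableD) auto
  define \<psi> where "\<psi> x = indicat_real (Q - {y}) x * u0 x" for x
  have \<psi>: "\<psi> \<in> borel_measurable lebesgue"
  proof (rule borel_measurable_LIMSEQ_real)
    \<comment> \<open>Compact sets exhausting \<open>Q - {y}\<close>, on each of which
      \<open>Lp_loc\<close> provides measurability.\<close>
    let ?K = "\<lambda>j. Q - ball y (1 / real (Suc j))"
    show "(\<lambda>x. indicat_real (?K j) x * u0 x) \<in> borel_measurable lebesgue" for j
    proof -
      have "compact (?K j)" using Q by (intro compact_diff) auto
      moreover have "?K j \<subseteq> X" using Q by auto
      ultimately show ?thesis using u0 by (auto simp: Lp_loc_def set_borel_measurable_def)
    qed
    fix x
    show "(\<lambda>j. indicat_real (?K j) x * u0 x) \<longlonglongrightarrow> \<psi> x"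
    proof (cases "x = y")
      case True
      then show ?thesis by (simp add: \<psi>_def)
    next
      case False
      then obtain J where J: "inverse (real (Suc J)) < dist y x"
        using reals_Archimedean[of "dist y x"] by auto
      have "indicat_real (?K j) x * u0 x = \<psi> x" if "J \<le> j" for j
      proof -
        have "1 / real (Suc j) \<le> inverse (real (Suc J))"
          using that by (simp add: field_simps)
        then have "x \<notin> ball y (1 / real (Suc j))" using J by auto
        then show ?thesis using False by (auto simp: \<psi>_def indicator_def)
      qed
      then have "\<forall>\<^sub>F j in sequentially. indicat_real (?K j) x * u0 x = \<psi> x"
        by (auto simp: eventually_sequentially)
      then show ?thesis by (rule tendsto_eventually)
    qed
  qed
  have hm: "(\<lambda>x. indicat_real Q x * h x) \<in> borel_measurable lebesgue"
    using absolutely_integrable_measurable_real Q h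
    by (metis (no_types, lifting) borel_measurable_continuous_on_indicator borel_compact
        measurable_completion real_scaleR_def measurable_lborel2 ext)
  have Qym: "Q - {y} \<in> sets lebesgue" using Qs by auto
  let ?g = "\<lambda>x. indicat_real (Q - {y}) x *\<^sub>R \<bar>h x - (min (u0 x) M + \<epsilon>)\<bar>"
  let ?g' = "\<lambda>x. indicat_real (Q - {y}) x *\<^sub>R \<bar>indicat_real Q x * h x - (min (\<psi> x) M + \<epsilon>)\<bar>"
  have "?g = ?g'" by (auto simp: \<psi>_def indicator_def fun_eq_iff)
  moreover have "?g' \<in> borel_measurable lebesgue" using hm \<psi> Qym by measurable
  ultimately have gm: "?g \<in> borel_measurable lebesgue" by simp
  obtain B where B: "\<And>x. x \<in> Q \<Longrightarrow> \<bar>h x\<bar> \<le> B"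
    using compact_imp_bounded[OF compact_continuous_image[OF h Q(1)]] by (auto simp: bounded_iff)
  have "integrable lebesgue ?g"
  proof (rule Bochner_Integration.integrable_bound[OF _ gm])
    show "integrable lebesgue (\<lambda>x. indicat_real Q x * (B + M + \<bar>\<epsilon>\<bar>))"
      using Q by (intro integrable_mult_left impI) (use Qs lmeasurable_compact[OF Q(1)] in \<open>auto simp: fmeasurable_def\<close>)
    show "AE x in lebesgue. norm (?g x) \<le> norm (indicat_real Q x * (B + M + \<bar>\<epsilon>\<bar>))"
      using u0_ge
    proof eventually_elim
      case (elim x)
      show ?case
      proof (cases "x \<in> Q - {y}")
        case True
        then have "0 \<le> min (u0 x) M" "min (u0 x) M \<le> M" using elim M by auto
        moreover have "\<bar>h x\<bar> \<le> B" using B True by auto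
        ultimately have "\<bar>h x - (min (u0 x) M + \<epsilon>)\<bar> \<le> \<bar>B + M + \<bar>\<epsilon>\<bar>\<bar>" by linarith
        then show ?thesis using True by (simp add: indicator_def)
      qed auto
    qed
  qed
  then show ?thesis
    unfolding set_integrable_def
    by (rule iffD1[OF integrable_discrete_difference[of "{y}"], rotated -1])
       (auto simp: indicator_def)
qed

text \<open>The order of limits matters. For fixed \<open>s0\<close> the barrier is bounded and fits
  below the truncated datum once \<open>M\<close> is large, whatever \<open>\<epsilon>\<close> is;
  the bound passes to the limits in \<open>\<epsilon>\<close> and then \<open>M\<close>, and only
  afterwards does \<open>s0\<close> tend to 0.\<close>

lemma constructed_solution_singular_lower_bound:
  fixes \<Omega> :: "'a::euclidean_space set" and y :: 'a and u :: "'a \<times> real \<Rightarrow> real" and m \<gamma> \<delta> l :: real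
  assumes m: "0 < m" "m < 1" and n: "2 \<le> DIM('a)" and m_crit: "m * real DIM('a) < real DIM('a) - 2"
    and \<Omega>: "open \<Omega>" and A: "finite A" "A \<subseteq> \<Omega>" "y \<in> A"
    and u0: "Lp_loc p (closure \<Omega> - A) u0" and \<delta>: "0 < \<delta>" and l: "0 < l"
    and \<gamma>: "real DIM('a) - 2 < m * \<gamma>"
    and sing: "AE x in lebesgue. 0 < norm (x - y) \<and> norm (x - y) < \<delta> \<longrightarrow> l / norm (x - y) powr \<gamma> \<le> u0 x"
    and u: "constructed_solution m \<Omega> A f u0 u"
  obtains k \<rho> where "0 < k" "0 < \<rho>" "cball y \<rho> - {y} \<subseteq> \<Omega> - A"
    "\<And>x t. 0 < t \<Longrightarrow> x \<in> cball y \<rho> - {y} \<Longrightarrow>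
      k * (dist y x powr (- (m * \<gamma>)) - \<rho> powr (- (m * \<gamma>))) \<le> u (x, t) powr m"
proof -
  define \<beta> where "\<beta> = m * \<gamma>"
  have \<beta>: "real DIM('a) - 2 < \<beta>" using \<gamma> by (simp add: \<beta>_def)
  have \<beta>0: "0 < \<beta>" using \<beta> n by linarith
  have \<beta>q: "2 < \<beta> * (1 / m - 1)"
  proof -
    have "2 * m < (real DIM('a) - 2) * (1 - m)" using m_crit by (simp add: algebra_simps)
    also have "\<dots> < \<beta> * (1 - m)" using \<beta> m by (intro mult_strict_right_mono) auto
    finally show ?thesis using m by (simp add: field_simps)
  qed
  \<comment> \<open>The box avoids the other singular points and lies within distance
    \<open>\<delta>\<close> of \<open>y\<close>, where \<open>sing\<close> applies.\<close>
  obtain a b where ab: "y \<in> box a b" "cbox a b \<subseteq> \<Omega> \<inter> ball y \<delta> - (A - {y})"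
  proof -
    have "open (\<Omega> \<inter> ball y \<delta> - (A - {y}))" using \<Omega> A by (intro open_Diff open_Int finite_imp_closed) auto
    moreover have "y \<in> \<Omega> \<inter> ball y \<delta> - (A - {y})" using A \<delta> by auto
    ultimately show ?thesis using that open_contains_cbox by metis
  qed
  then obtain \<rho> where \<rho>: "0 < \<rho>" "cball y \<rho> \<subseteq> box a b"
    by (meson open_box open_contains_cball)
  have ball_sub: "cball y \<rho> - {y} \<subseteq> \<Omega> - A"
    using \<rho>(2) ab(2) box_subset_cbox[of a b] by blast
  \<comment> \<open>Chosen so that \<open>(k * dist y x powr (- \<beta>)) powr (1 / m)\<close>
    equals \<open>l * dist y x powr (- \<gamma>)\<close>, the lower bound for
    \<open>u0\<close>.\<close>
  define k where "k = l powr m"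
  have k: "0 < k" using l by (simp add: k_def)
  define B where "B = \<rho> powr (- \<beta>)"
  have B: "0 < B" using \<rho> by (simp add: B_def)
  obtain c \<sigma> where c: "0 < c" and \<sigma>: "0 < \<sigma>" and
    sub: "\<And>X s w. 0 \<le> X \<Longrightarrow> 0 < s \<Longrightarrow> s \<le> \<sigma> \<Longrightarrow> w = k * ((X + s) powr (- (\<beta> / 2)) - B) \<Longrightarrow> 0 < w \<Longrightarrow>
      (1 / m) * w powr (1 / m - 1) * (k * (- (\<beta> / 2) * (X + s) powr (- (\<beta> / 2) - 1) * (c * s)))
      \<le> k * (2 * (- (\<beta> / 2)) * (X + s) powr (- (\<beta> / 2) - 2) *
        ((2 * (- (\<beta> / 2)) - 2 + real DIM('a)) * X + real DIM('a) * s))"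
    using concentrated_barrier_subsolution[of m "real DIM('a)" \<beta> k B] m n \<beta>0 \<beta> \<beta>q k B by auto
  obtain v w where
    approx: "\<And>\<epsilon> M. 0 < \<epsilon> \<Longrightarrow> \<epsilon> < 1 \<Longrightarrow> 0 < M \<Longrightarrow> approx_solution m \<Omega> f u0 \<epsilon> M (v \<epsilon> M)"
    and lim_w: "\<And>M z. 0 < M \<Longrightarrow> z \<in> (\<Omega> - A) \<times> {0<..} \<Longrightarrow> ((\<lambda>\<epsilon>. v \<epsilon> M z) \<longlongrightarrow> w M z) (at_right 0)"
    and lim_u: "\<And>z. z \<in> (\<Omega> - A) \<times> {0<..} \<Longrightarrow> ((\<lambda>M. w M z) \<longlongrightarrow> u z) at_top"
    using u unfolding constructed_solution_def by blast
  have powr_half: "((x - y) \<bullet> (x - y)) powr (- (\<beta> / 2)) = dist y x powr (- \<beta>)" for x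
  proof -
    have "(x - y) \<bullet> (x - y) = dist y x powr 2"
      by (simp add: dist_norm norm_minus_commute power2_norm_eq_inner[symmetric])
    then show ?thesis by (simp only: powr_powr) simp
  qed
  have v_ge: "k * (((x - y) \<bullet> (x - y) + s0 * exp (c * T)) powr (- (\<beta> / 2)) - B) \<le> v \<epsilon> M (x, T) powr m"
    if T: "0 < T" and x: "x \<in> cbox a b" and s0: "0 < s0" "s0 * exp (c * T) \<le> \<sigma>"
      and \<epsilon>: "0 < \<epsilon>" "\<epsilon> < 1" and M: "0 < M" "(k * s0 powr (- (\<beta> / 2))) powr (1 / m) \<le> M" for x T s0 \<epsilon> M
  proof -
    have sol: "dirichlet_solution m \<Omega> {} (\<lambda>z. f z + \<epsilon>) (\<lambda>x. min (u0 x) M + \<epsilon>) (v \<epsilon> M)"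
      and ge: "\<And>x t. x \<in> \<Omega> \<Longrightarrow> 0 < t \<Longrightarrow> \<epsilon> \<le> v \<epsilon> M (x, t)"
      using approx[OF \<epsilon> M(1)] by (auto simp: approx_solution_def)
    \<comment> \<open>The approximations are classical across the points of \<open>A\<close>, so the
      comparison can take place on a full box around \<open>y\<close>.\<close>
    obtain v1 v2 where "fde_solution m \<Omega> (v \<epsilon> M) (time_deriv (v \<epsilon> M)) v1 v2"
      using fde_solution_dirichlet_solution[OF sol _ m] \<Omega> by auto
    then interpret fde_solution m \<Omega> "v \<epsilon> M" "time_deriv (v \<epsilon> M)" v1 v2 .
    have sing': "AE x in lebesgue. x \<in> cbox a b - {y} \<longrightarrow> l / norm (x - y) powr \<gamma> \<le> u0 x"
      using sing
    proof eventually_elim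
      case (elim x)
      have "norm (x - y) < \<delta>" if "x \<in> cbox a b"
        using that ab(2) by (auto simp: dist_norm norm_minus_commute)
      then show ?case using elim by auto
    qed
    show ?thesis
      unfolding B_def
    proof (rule concentrated_barrier_le[where g = "\<lambda>x. min (u0 x) M + \<epsilon>" and a = a and b = b and \<sigma> = \<sigma>
          and \<epsilon> = \<epsilon>])
      show "cbox a b \<subseteq> \<Omega>" using ab by auto
      show "((\<lambda>t. LINT x:cbox a b|lebesgue. \<bar>v \<epsilon> M (x, t) - (min (u0 x) M + \<epsilon>)\<bar>) \<longlongrightarrow> 0) (at_right 0)"
      proof -
        have "\<forall>K. compact K \<longrightarrow> K \<subseteq> \<Omega> \<longrightarrow>
            ((\<lambda>t. LINT x:K|lebesgue. \<bar>v \<epsilon> M (x, t) - (min (u0 x) M + \<epsilon>)\<bar>) \<longlongrightarrow> 0) (at_right 0)"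
          using sol by (simp add: dirichlet_solution_def)
        then show ?thesis using ab(2) compact_cbox by blast
      qed
      fix t :: real assume "0 < t"
      show "set_integrable lebesgue (cbox a b) (\<lambda>x. \<bar>v \<epsilon> M (x, t) - (min (u0 x) M + \<epsilon>)\<bar>)"
      proof (rule set_integrable_initial_difference[OF u0 _ _ _ _ M(1)])
        show "cbox a b - {y} \<subseteq> closure \<Omega> - A" using ab(2) closure_subset[of \<Omega>] by blast
        show "continuous_on (cbox a b) (\<lambda>x. v \<epsilon> M (x, t))"
          using ab(2) \<open>0 < t\<close> by (intro continuous_on_compose2[OF cont_u] continuous_intros) auto
        show "AE x in lebesgue. x \<in> cbox a b - {y} \<longrightarrow> 0 \<le> u0 x"
          using sing' by eventually_elim (use l in \<open>auto intro: order_trans[rotated]\<close>)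
      qed auto
    next
      have "AE x in lebesgue. x \<noteq> y"
        using AE_lborel_singleton[of y] by (auto intro: AE_completion)
      with sing' show "AE x in lebesgue. x \<in> cbox a b \<longrightarrow>
          (k * ((x - y) \<bullet> (x - y) + s0) powr (- (\<beta> / 2))) powr (1 / m) \<le> min (u0 x) M + \<epsilon>"
      proof eventually_elim
        case (elim x)
        show ?case
        proof
          assume x: "x \<in> cbox a b"
          let ?N = "(x - y) \<bullet> (x - y) + s0"
          have xy: "0 < dist y x" using elim by simp
          have "?N powr (- (\<beta> / 2)) \<le> ((x - y) \<bullet> (x - y)) powr (- (\<beta> / 2))"
            using elim s0 \<beta>0 by (intro powr_mono2') auto
          then have "(k * ?N powr (- (\<beta> / 2))) powr (1 / m) \<le> (k * dist y x powr (- \<beta>)) powr (1 / m)"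
            unfolding powr_half using k m by (intro powr_mono2 mult_left_mono) auto
          also have "\<dots> = l * dist y x powr (- \<gamma>)"
            using m l by (simp add: powr_mult powr_powr k_def \<beta>_def)
          also have "\<dots> = l / norm (x - y) powr \<gamma>"
            by (simp add: dist_norm norm_minus_commute powr_minus_divide)
          also have "\<dots> \<le> u0 x" using elim x by auto
          finally have 1: "(k * ?N powr (- (\<beta> / 2))) powr (1 / m) \<le> u0 x" .
          have "?N powr (- (\<beta> / 2)) \<le> s0 powr (- (\<beta> / 2))"
            using s0 \<beta>0 by (intro powr_mono2') auto
          then have "k * ?N powr (- (\<beta> / 2)) \<le> k * s0 powr (- (\<beta> / 2))"
            using k by (intro mult_left_mono) auto
          then have "(k * ?N powr (- (\<beta> / 2))) powr (1 / m) \<le> (k * s0 powr (- (\<beta> / 2))) powr (1 / m)"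
            using k m by (intro powr_mono2) auto
          then show "(k * ?N powr (- (\<beta> / 2))) powr (1 / m) \<le> min (u0 x) M + \<epsilon>"
            using 1 M \<epsilon> by linarith
        qed
      qed
    qed (use sub ge \<beta>0 k \<rho> c \<epsilon> s0 x T in \<open>auto simp: B_def\<close>)
  qed
  have u_ge: "k * (dist y x powr (- \<beta>) - B) \<le> u (x, T) powr m"
    if T: "0 < T" and x: "x \<in> cball y \<rho> - {y}" for x T
  proof -
    have z: "(x, T) \<in> (\<Omega> - A) \<times> {0<..}" using ball_sub x T by auto
    have u_pos: "0 < u (x, T)"
      using u z by (auto simp: constructed_solution_def blowup_solution_def dirichlet_solution_def)
    have xQ: "x \<in> cbox a b" using x \<rho>(2) box_subset_cbox[of a b] by auto
    let ?L = "\<lambda>s0. k * (((x - y) \<bullet> (x - y) + s0 * exp (c * T)) powr (- (\<beta> / 2)) - B)"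
    have L_le: "?L s0 \<le> u (x, T) powr m" if s0: "0 < s0" "s0 < \<sigma> * exp (- (c * T))" for s0
    proof -
      have s0': "s0 * exp (c * T) \<le> \<sigma>"
        using s0 mult_right_mono[of s0 "\<sigma> * exp (- (c * T))" "exp (c * T)"] by (simp add: exp_minus field_simps)
      \<comment> \<open>Convergence is known for \<open>v\<close> and \<open>w\<close> themselves,
        so the bound is moved from their powers to the functions; the positive part covers the case
        that \<open>?L s0\<close> is negative.\<close>
      let ?l = "max 0 (?L s0) powr (1 / m)"
      let ?M0 = "(k * s0 powr (- (\<beta> / 2))) powr (1 / m)"
      have v_ge': "?l \<le> v \<epsilon> M (x, T)" if \<epsilon>: "0 < \<epsilon>" "\<epsilon> < 1" and M: "0 < M" "?M0 \<le> M" for \<epsilon> M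
      proof -
        have v0: "\<epsilon> \<le> v \<epsilon> M (x, T)"
          using approx[OF \<epsilon> M(1)] z by (auto simp: approx_solution_def)
        have "max 0 (?L s0) \<le> v \<epsilon> M (x, T) powr m"
          using v_ge[OF T xQ s0(1) s0' \<epsilon> M] by simp
        then have "?l \<le> (v \<epsilon> M (x, T) powr m) powr (1 / m)"
          using m by (intro powr_mono2) auto
        then show ?thesis using m v0 \<epsilon> by (simp add: powr_powr)
      qed
      have w_ge: "?l \<le> w M (x, T)" if M: "0 < M" "?M0 \<le> M" for M
      proof (rule tendsto_lowerbound[OF lim_w[OF M(1) z]])
        show "\<forall>\<^sub>F \<epsilon> in at_right 0. ?l \<le> v \<epsilon> M (x, T)"
          unfolding eventually_at_right_field using v_ge' M by (intro exI[of _ 1]) auto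
      qed simp
      have "?l \<le> u (x, T)"
      proof (rule tendsto_lowerbound[OF lim_u[OF z]])
        show "\<forall>\<^sub>F M in at_top. ?l \<le> w M (x, T)"
          using eventually_gt_at_top[of 0] eventually_ge_at_top[of ?M0] by eventually_elim (rule w_ge)
      qed simp
      then have "?l powr m \<le> u (x, T) powr m" using m by (intro powr_mono2) auto
      then show ?thesis using m by (simp add: powr_powr)
    qed
    have pos: "0 < (x - y) \<bullet> (x - y)" using x by auto
    have "(?L \<longlongrightarrow> k * (((x - y) \<bullet> (x - y) + 0 * exp (c * T)) powr (- (\<beta> / 2)) - B)) (at_right 0)"
      using pos by (intro tendsto_intros) auto
    then have "k * (((x - y) \<bullet> (x - y) + 0 * exp (c * T)) powr (- (\<beta> / 2)) - B) \<le> u (x, T) powr m"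
    proof (rule tendsto_upperbound)
      show "\<forall>\<^sub>F s0 in at_right 0. ?L s0 \<le> u (x, T) powr m"
        unfolding eventually_at_right_field using L_le \<sigma> by (intro exI[of _ "\<sigma> * exp (- (c * T))"]) auto
    qed simp
    then show ?thesis by (simp add: powr_half)
  qed
  show ?thesis
    using that[OF k \<rho>(1) ball_sub] u_ge by (simp add: B_def \<beta>_def)
qed

section \<open>Blow-up in infinite time\<close>

context fde_solution
begin

text \<open>The radius is fixed before \<open>C\<close>, so one small sphere around \<open>y\<close>
  carries arbitrarily large lower bounds for the propagation.\<close>

definition blows_up_near :: "'a \<Rightarrow> bool" where
  "blows_up_near y \<longleftrightarrow> (\<exists>r>0. \<forall>C. \<forall>\<^sub>F t in at_top. \<forall>x\<in>ball y r. C \<le> u (x, t))"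

text \<open>On a small sphere around \<open>z\<close> any height \<open>H\<close> is eventually
  exceeded, and \<open>annulus_lower_bound\<close> carries a fixed fraction \<open>\<theta>\<close>
  of it to distance \<open>R1\<close>.\<close>

lemma blows_up_near_ball:
  assumes z: "blows_up_near z" and R: "cball z R \<subseteq> S" and y: "dist z y < R"
  shows "blows_up_near y"
proof -
  obtain r0 where r0: "0 < r0" "\<And>C. \<forall>\<^sub>F t in at_top. \<forall>x\<in>ball z r0. C \<le> u (x, t)"
    using z by (auto simp: blows_up_near_def)
  have R0: "0 < R" using y zero_le_dist[of z y] by linarith
  define r where "r = min r0 R / 2"
  have r: "0 < r" "r < r0" "r < R" using r0 R0 by (auto simp: r_def)
  define R1 where "R1 = (dist z y + R) / 2"
  have R1: "dist z y < R1" "R1 < R" using y by (auto simp: R1_def)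
  have R1_pos: "0 < R1" using R1 zero_le_dist[of z y] by linarith
  \<comment> \<open>No rate of growth has to be transported here, so any exponent above
    \<open>DIM('a) - 2\<close> serves.\<close>
  define n where "n = real DIM('a)"
  have n: "0 < n" "real DIM('a) - 2 < n" by (auto simp: n_def)
  define \<theta> where "\<theta> = r powr n * (R1 powr (- n) - R powr (- n))"
  have "R powr (- n) < R1 powr (- n)" using R1 R1_pos n by (intro powr_less_mono2_neg) auto
  then have \<theta>: "0 < \<theta>" using r by (simp add: \<theta>_def)
  have "\<forall>\<^sub>F t in at_top. \<forall>x\<in>ball y (R1 - dist z y). C \<le> u (x, t)" for C
  proof -
    \<comment> \<open>A positive target lets a comparison of \<open>m\<close>-th powers be turned
      back into one of values.\<close>
    define C1 where "C1 = max C 1"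
    define H where "H = C1 powr m / \<theta>"
    have H: "0 < H" using \<theta> by (simp add: H_def C1_def)
    obtain T0 where "\<forall>t\<ge>T0. \<forall>x\<in>ball z r0. max C1 (H powr (1 / m)) \<le> u (x, t)"
      using r0(2)[of "max C1 (H powr (1 / m))"] unfolding eventually_at_top_linorder by blast
    then have T0: "\<And>t x. T0 \<le> t \<Longrightarrow> x \<in> ball z r0 \<Longrightarrow> max C1 (H powr (1 / m)) \<le> u (x, t)" by blast
    define T0' where "T0' = max T0 1"
    have inner: "H \<le> u (x, t) powr m" if "dist z x = r" "T0' \<le> t" for x t
    proof -
      have "H powr (1 / m) \<le> u (x, t)" using T0[of t x] that r by (auto simp: T0'_def)
      then have "(H powr (1 / m)) powr m \<le> u (x, t) powr m" using m_pos by (intro powr_mono2) auto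
      then show ?thesis using H m_pos by (simp add: powr_powr)
    qed
    have "cball z R - ball z r \<subseteq> S" "0 < T0'" using R by (auto simp: T0'_def)
    then obtain T1 where T1: "T0' \<le> T1" "\<And>x t. T1 \<le> t \<Longrightarrow> r \<le> dist z x \<Longrightarrow> dist z x \<le> R \<Longrightarrow>
       H * r powr n * (dist z x powr (- n) - R powr (- n)) \<le> u (x, t) powr m"
      using annulus_lower_bound[OF r(1,3) _ H n _ inner] by metis
    have "C \<le> u (x, t)" if t: "T1 \<le> t" and x: "x \<in> ball y (R1 - dist z y)" for x t
    proof (cases "dist z x < r")
      case True
      then have "C1 \<le> u (x, t)" using T0[of t x] t T1 r by (auto simp: T0'_def)
      then show ?thesis by (simp add: C1_def)
    next
      case False
      have zx: "dist z x \<le> R1" using x dist_triangle[of z x y] by simp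
      have "R1 powr (- n) \<le> dist z x powr (- n)"
        using zx False r n by (intro powr_mono2') auto
      then have "H * \<theta> \<le> H * r powr n * (dist z x powr (- n) - R powr (- n))"
        using H r by (simp add: \<theta>_def)
      also have "\<dots> \<le> u (x, t) powr m" using T1(2)[OF t, of x] False zx R1 by simp
      finally have le: "C1 powr m \<le> u (x, t) powr m" using \<theta> by (simp add: H_def)
      have "0 < t" using t T1 by (auto simp: T0'_def)
      moreover have "x \<in> S" using zx R1 R by auto
      ultimately have "0 < u (x, t)" using u_pos by blast
      moreover have "0 < C1" by (simp add: C1_def)
      ultimately have "C1 \<le> u (x, t)" using le m_pos by (meson not_le powr_less_mono2 less_imp_le)
      then show ?thesis by (simp add: C1_def)
    qed
    then show ?thesis unfolding eventually_at_top_linorder by blast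
  qed
  then show ?thesis
    unfolding blows_up_near_def using R1 by (intro exI[of _ "R1 - dist z y"]) auto
qed

text \<open>Connectedness spreads blow-up from one point to all of \<open>S\<close>; a finite
  subcover then makes the waiting time uniform over \<open>K\<close>.\<close>

theorem blows_up_uniformly_on_compact:
  assumes S: "connected S" and y: "y \<in> S" "blows_up_near y" and K: "compact K" "K \<subseteq> S"
  shows "\<forall>\<^sub>F t in at_top. \<forall>x\<in>K. C \<le> u (x, t)"
proof -
  let ?G = "{z \<in> S. blows_up_near z}"
  let ?F = "{z \<in> S. \<not> blows_up_near z}"
  have "open ?G"
    unfolding open_contains_ball
  proof
    fix z assume z: "z \<in> ?G"
    then obtain R where R: "0 < R" "cball z R \<subseteq> S" using open_S open_contains_cball by blast
    then have "ball z R \<subseteq> ?G" using z blows_up_near_ball[of z R] by auto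
    then show "\<exists>e>0. ball z e \<subseteq> ?G" using R by blast
  qed
  moreover have "open ?F"
    unfolding open_contains_ball
  proof
    fix z assume z: "z \<in> ?F"
    then obtain R where R: "0 < R" "cball z R \<subseteq> S" using open_S open_contains_cball by blast
    \<comment> \<open>A blow-up point \<open>x\<close> within \<open>R / 2\<close> of
      \<open>z\<close> would reach \<open>z\<close> through the ball of radius \<open>R / 2\<close>
      around \<open>x\<close>, which stays inside \<open>S\<close>.\<close>
    have "\<not> blows_up_near x" if x: "x \<in> ball z (R / 2)" for x
    proof
      assume "blows_up_near x"
      moreover have "cball x (R / 2) \<subseteq> cball z R"
      proof
        fix x' assume "x' \<in> cball x (R / 2)"
        then show "x' \<in> cball z R" using x dist_triangle[of z x' x] by simp
      qed
      moreover have "dist x z < R / 2" using x by (simp add: dist_commute)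
      ultimately have "blows_up_near z" using blows_up_near_ball R by blast
      then show False using z by simp
    qed
    moreover have "ball z (R / 2) \<subseteq> S" using R by (auto simp: subset_iff)
    ultimately have "ball z (R / 2) \<subseteq> ?F" by blast
    then show "\<exists>e>0. ball z e \<subseteq> ?F" using R by (intro exI[of _ "R / 2"]) auto
  qed
  ultimately have "?G \<inter> S = {} \<or> ?F \<inter> S = {}"
    by (intro connectedD[OF S]) auto
  then have all: "blows_up_near z" if "z \<in> K" for z using that y K by blast
  have "\<forall>z\<in>K. \<exists>r. 0 < r \<and> (\<forall>\<^sub>F t in at_top. \<forall>x\<in>ball z r. C \<le> u (x, t))"
    using all unfolding blows_up_near_def by blast
  from bchoice[OF this] obtain r where r: "\<And>z. z \<in> K \<Longrightarrow> 0 < r z"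
    "\<And>z. z \<in> K \<Longrightarrow> \<forall>\<^sub>F t in at_top. \<forall>x\<in>ball z (r z). C \<le> u (x, t)"
    by blast
  obtain K' where K': "K' \<subseteq> K" "finite K'" "K \<subseteq> (\<Union>z\<in>K'. ball z (r z))"
    using compactE_image[OF K(1), of K "\<lambda>z. ball z (r z)"] r(1) by force
  have "\<forall>\<^sub>F t in at_top. \<forall>z\<in>K'. \<forall>x\<in>ball z (r z). C \<le> u (x, t)"
    using K' r(2) by (intro eventually_ball_finite) auto
  then show ?thesis
    by eventually_elim (use K'(3) in blast)
qed

text \<open>The sphere of radius \<open>r\<close> carries a bound \<open>H\<close> of order
  \<open>r powr (- \<beta>)\<close>. Transport with an exponent \<open>b < \<beta>\<close> retains a
  multiple of \<open>H * r powr b\<close>, of order \<open>r powr (b - \<beta>)\<close>, which is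
  unbounded as \<open>r\<close> shrinks.\<close>

lemma singular_lower_bound_imp_blows_up_near:
  assumes k: "0 < k" and \<rho>: "0 < \<rho>" "cball y \<rho> - {y} \<subseteq> S"
    and \<beta>: "real DIM('a) - 2 < \<beta>" and n: "2 \<le> DIM('a)"
    and lower: "\<And>x t. 0 < t \<Longrightarrow> x \<in> cball y \<rho> - {y} \<Longrightarrow>
      k * (dist y x powr (- \<beta>) - \<rho> powr (- \<beta>)) \<le> u (x, t) powr m"
  obtains z where "z \<in> S" "blows_up_near z"
proof -
  obtain i :: 'a where i: "i \<in> Basis" using nonempty_Basis by blast
  \<comment> \<open>The ball of radius \<open>\<rho> / 8\<close> around \<open>z\<close> stays
    between the radii \<open>\<rho> / 4\<close> and \<open>\<rho> / 2\<close> about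
    \<open>y\<close>, clear of every inner sphere of radius
    \<open>r \<le> \<rho> / 8\<close>.\<close>
  define z where "z = y + (3 * \<rho> / 8) *\<^sub>R i"
  have yz: "dist y z = 3 * \<rho> / 8" using i \<rho> by (simp add: z_def dist_norm)
  have zS: "z \<in> S" using \<rho> yz by (intro subsetD[OF \<rho>(2)]) auto
  define b where "b = (real DIM('a) - 2 + \<beta>) / 2"
  have b: "0 < b" "real DIM('a) - 2 < b" "b < \<beta>" using \<beta> n by (auto simp: b_def)
  define \<theta> where "\<theta> = (\<rho> / 2) powr (- b) - \<rho> powr (- b)"
  have "\<rho> powr (- b) < (\<rho> / 2) powr (- b)" using \<rho> b by (intro powr_less_mono2_neg) auto
  then have \<theta>: "0 < \<theta>" by (simp add: \<theta>_def)
  have "\<forall>\<^sub>F t in at_top. \<forall>x\<in>ball z (\<rho> / 8). C \<le> u (x, t)" for C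
  proof -
    define C1 where "C1 = max C 1"
    \<comment> \<open>The first summand is the size that yields \<open>C1\<close>; the second
      absorbs the loss \<open>r powr b * \<rho> powr (- \<beta>)\<close>. The radius
      \<open>r\<close> is taken so small that \<open>r powr (b - \<beta>) \<ge> X\<close>.\<close>
    define X where "X = C1 powr m / (k * \<theta>) + \<rho> powr (b - \<beta>)"
    have X: "0 < X" using k \<theta> \<rho> by (simp add: X_def C1_def add_pos_pos)
    define r where "r = min (\<rho> / 8) (X powr (- (1 / (\<beta> - b))))"
    have r: "0 < r" "r \<le> \<rho> / 8" "r < \<rho>" using \<rho> X by (auto simp: r_def)
    define H where "H = k * (r powr (- \<beta>) - \<rho> powr (- \<beta>))"
    have "\<rho> powr (- \<beta>) < r powr (- \<beta>)" using r b by (intro powr_less_mono2_neg) auto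
    then have H: "0 < H" using k by (simp add: H_def)
    have "- (1 / (\<beta> - b)) * (b - \<beta>) = 1" using b by (simp add: field_simps)
    then have "X = (X powr (- (1 / (\<beta> - b)))) powr (b - \<beta>)" using X by (simp only: powr_powr) simp
    also have "\<dots> \<le> r powr (b - \<beta>)" using r b by (intro powr_mono2') (auto simp: r_def)
    finally have "C1 powr m / (k * \<theta>) \<le> r powr (b - \<beta>) - \<rho> powr (b - \<beta>)" by (simp add: X_def)
    also have "\<dots> \<le> r powr (b - \<beta>) - r powr b * \<rho> powr (- \<beta>)"
    proof -
      have "r powr b * \<rho> powr (- \<beta>) \<le> \<rho> powr b * \<rho> powr (- \<beta>)"
        using r b by (intro mult_right_mono powr_mono2) auto
      also have "\<dots> = \<rho> powr (b - \<beta>)" using \<rho> by (simp add: powr_add[symmetric])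
      finally show ?thesis by simp
    qed
    also have "\<dots> = r powr b * (r powr (- \<beta>) - \<rho> powr (- \<beta>))"
      using r by (simp add: right_diff_distrib powr_add[symmetric])
    finally have "C1 powr m \<le> k * \<theta> * (r powr b * (r powr (- \<beta>) - \<rho> powr (- \<beta>)))"
      using k \<theta> by (simp add: field_simps)
    then have HC: "C1 powr m \<le> H * r powr b * \<theta>" by (simp add: H_def mult_ac)
    have inner: "H \<le> u (x, t) powr m" if "dist y x = r" "1 \<le> t" for x t
      using lower[of t x] that r by (auto simp: H_def)
    have "cball y \<rho> - ball y r \<subseteq> S" using \<rho>(2) r by (auto simp: subset_iff)
    then obtain T1 where T1: "1 \<le> T1" "\<And>x t. T1 \<le> t \<Longrightarrow> r \<le> dist y x \<Longrightarrow> dist y x \<le> \<rho> \<Longrightarrow>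
       H * r powr b * (dist y x powr (- b) - \<rho> powr (- b)) \<le> u (x, t) powr m"
      using annulus_lower_bound[OF r(1,3) _ H b(1,2) zero_less_one inner] by metis
    have "C \<le> u (x, t)" if t: "T1 \<le> t" and x: "x \<in> ball z (\<rho> / 8)" for x t
    proof -
      have d: "r \<le> dist y x" "dist y x \<le> \<rho> / 2"
        using x yz r dist_triangle[of y z x] dist_triangle[of y x z] by (auto simp: dist_commute)
      have "(\<rho> / 2) powr (- b) \<le> dist y x powr (- b)"
        using d r b by (intro powr_mono2') auto
      then have "H * r powr b * \<theta> \<le> H * r powr b * (dist y x powr (- b) - \<rho> powr (- b))"
        using H by (intro mult_left_mono) (auto simp: \<theta>_def)
      also have "\<dots> \<le> u (x, t) powr m" using T1(2)[OF t] d \<rho> by simp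
      finally have le: "C1 powr m \<le> u (x, t) powr m" using HC by linarith
      have "x \<in> S" using d r \<rho> by (intro subsetD[OF \<rho>(2)]) auto
      then have "0 < u (x, t)" using u_pos t T1 by auto
      moreover have "0 < C1" by (simp add: C1_def)
      ultimately have "C1 \<le> u (x, t)" using le m_pos by (meson not_le powr_less_mono2 less_imp_le)
      then show ?thesis by (simp add: C1_def)
    qed
    then show ?thesis unfolding eventually_at_top_linorder by blast
  qed
  then have "blows_up_near z"
    unfolding blows_up_near_def using \<rho> by (intro exI[of _ "\<rho> / 8"]) auto
  then show ?thesis using that zS by blast
qed

end

section \<open>Application to the punctured domain\<close>

theorem theorem1p8:
  fixes \<Omega> :: "(real ^ 'n) set" and a :: "nat \<Rightarrow> real ^ 'n" and i0 :: nat
    and m \<mu>\<^sub>0 p \<delta>\<^sub>0 \<delta>\<^sub>1 :: real and lam \<gamma> :: "nat \<Rightarrow> real"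
    and u\<^sub>0 :: "real ^ 'n \<Rightarrow> real" and f u :: "(real ^ 'n) \<times> real \<Rightarrow> real"
  assumes dim: "CARD('n) \<ge> 3"
    and m: "0 < m" "m < (real CARD('n) - 2) / real CARD('n)"
    and mu: "0 < \<mu>\<^sub>0"
    and dom: "smooth_bounded_domain \<Omega>"
    and pts: "1 \<le> i0" "inj_on a {1..i0}" "a ` {1..i0} \<subseteq> \<Omega>"
    and delta0: "\<delta>\<^sub>0 = 1 / 3 * Min ({infdist (a i) (frontier \<Omega>) | i. i \<in> {1..i0}}
                   \<union> {norm (a i - a j) | i j. i \<in> {1..i0} \<and> j \<in> {1..i0} \<and> i \<noteq> j})"
    and p: "p > real CARD('n) * (1 - m) / 2"
    and u0_Lp: "Lp_loc p (closure \<Omega> - a ` {1..i0}) u\<^sub>0"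
    and u0_ge: "AE x in lebesgue. x \<in> \<Omega> - a ` {1..i0} \<longrightarrow> \<mu>\<^sub>0 \<le> u\<^sub>0 x"
    and delta1: "0 < \<delta>\<^sub>1" "\<delta>\<^sub>1 < \<delta>\<^sub>0"
    and lam: "\<And>i. i \<in> {1..i0} \<Longrightarrow> 0 < lam i"
    and u0_sing: "\<And>i. i \<in> {1..i0} \<Longrightarrow>
        AE x in lebesgue. 0 < norm (x - a i) \<and> norm (x - a i) < \<delta>\<^sub>1 \<longrightarrow>
          u\<^sub>0 x \<ge> lam i / norm (x - a i) powr \<gamma> i"
    and gamma1: "\<gamma> 1 > (real CARD('n) - 2) / m"
    and gamma: "\<And>i. i \<in> {2..i0} \<Longrightarrow> \<gamma> i > 2 / (1 - m)"
    and f_Linf: "Linf (lateral_measure \<Omega>) f"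
    and f_ge: "AE z in lateral_measure \<Omega>. \<mu>\<^sub>0 \<le> f z"
    and u: "constructed_solution m \<Omega> (a ` {1..i0}) f u\<^sub>0 u"
  shows "\<forall>K. compact K \<longrightarrow> K \<subseteq> \<Omega> - a ` {1..i0} \<longrightarrow>
           (\<forall>C::real. \<forall>\<^sub>F t in at_top. \<forall>x\<in>K. C \<le> u (x, t))"
proof -
  let ?A = "a ` {1..i0}"
  have n: "real DIM(real ^ 'n) = real CARD('n)" "3 \<le> DIM(real ^ 'n)" using dim by auto
  have m_crit: "m * real CARD('n) < real CARD('n) - 2"
    using m(2) dim by (simp add: pos_less_divide_eq)
  have m1: "m < 1"
  proof -
    have "(real CARD('n) - 2) / real CARD('n) < 1" using dim by simp
    then show ?thesis using m by linarith
  qed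
  have \<Omega>: "open \<Omega>" "connected \<Omega>" using dom by (auto simp: smooth_bounded_domain_def)
  then have op: "open (\<Omega> - ?A)" by (intro open_Diff finite_imp_closed) auto
  \<comment> \<open>In dimension at least two, deleting finitely many points keeps a connected open
    set connected, so the propagation can go around the singularities.\<close>
  have conn: "connected (\<Omega> - ?A)"
    using \<Omega> n by (intro connected_open_delete_finite) auto
  have one: "1 \<in> {1..i0}" using pts by simp
  have sol: "dirichlet_solution m \<Omega> ?A f u\<^sub>0 u"
    using u by (simp add: constructed_solution_def blowup_solution_def)
  obtain v1 v2 where "fde_solution m (\<Omega> - ?A) u (time_deriv u) v1 v2"
    using fde_solution_dirichlet_solution[OF sol op m(1) m1] by blast
  then interpret fde_solution m "\<Omega> - ?A" u "time_deriv u" v1 v2 .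
  have \<gamma>: "real CARD('n) - 2 < m * \<gamma> 1"
    using gamma1 m(1) by (simp add: pos_divide_less_eq mult.commute)
  obtain k \<rho> where lower: "0 < k" "0 < \<rho>" "cball (a 1) \<rho> - {a 1} \<subseteq> \<Omega> - ?A"
    "\<And>x t. 0 < t \<Longrightarrow> x \<in> cball (a 1) \<rho> - {a 1} \<Longrightarrow>
      k * (dist (a 1) x powr (- (m * \<gamma> 1)) - \<rho> powr (- (m * \<gamma> 1))) \<le> u (x, t) powr m"
  proof (rule constructed_solution_singular_lower_bound[OF m(1) m1 _ _ \<Omega>(1) _ pts(3) _ u0_Lp delta1(1)
        lam[OF one] _ u0_sing[OF one] u])
    show "a 1 \<in> ?A" using one by (rule imageI)
  qed (use n m_crit \<gamma> in simp_all)
  obtain z where "z \<in> \<Omega> - ?A" "blows_up_near z"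
  proof (rule singular_lower_bound_imp_blows_up_near[OF lower(1-3) _ _ lower(4)])
    show "real DIM(real ^ 'n) - 2 < m * \<gamma> 1" "2 \<le> DIM(real ^ 'n)" using \<gamma> n by simp_all
  qed
  then show ?thesis
    using blows_up_uniformly_on_compact[OF conn] by blast
qed

end
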